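(* Let $K\geq1$, $M\geq K$, $L\geq0$, $N\geq0$ and $d\geq2$ be integers, let $\mu^{(1)},\dots,\mu^{(N)}$ be partitions of $d$, let $a_1,\dots,a_L,b_1,\dots,b_{M-K}$ be fixed non-negative integers, and let $$G(z)=\frac{(1+u_1z)\cdots(1+u_Lz)}{(1-z)^K(1-v_1z)\cdots(1-v_{M-K}z)}$$ with formal variables $u_1,\dots,u_L,v_1,\dots,v_{M-K}$. Then $$\Big[\prod_{i=1}^Lu_i^{a_i}\prod_{j=1}^{M-K}v_j^{b_j}\Big]H_r^{G,\circ}(\mu^{(1)},\dots,\mu^{(N)})\sim 2\,\frac{r^{K-1}}{(K-1)!}\,\frac{(d-1)^{(d-2)K-\sum a_i-\sum b_j+r}}{d!^2\,(d-2)!^K}\prod_{i=1}^L\biggl[\begin{matrix}d\\d-a_i\end{matrix}\biggr]\prod_{j=1}^{M-K}\biggl\{\begin{matrix}b_j+d-1\\d-1\end{matrix}\biggr\}$$ as $g\to+\infty$, with $r=2g-2-d(N-2)+\sum_{j=1}^N\ell(\mu^{(j)})$.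
   Context: $\ell(\mu)$ is the length of a partition $\mu$; $|\mathfrak{C}_\mu|$ is the number of permutations of cycle type $\mu\vdash d$ in the symmetric group on $d$ elements; $\chi_\lambda(\mathcal{C}_\mu)$ is the value of the irreducible character indexed by $\lambda$ on such a permutation, and $\dim\lambda$ the dimension of the irreducible representation. $Y_\lambda=\{(i,j):1\leq i\leq\ell(\lambda),\,1\leq j\leq\lambda_i\}$ is the Young diagram of $\lambda$. For $G(z)$ a power series in $z$ with constant term $1$, the possibly disconnected hypergeometric Hurwitz numbers are $$H_r^{G,\bullet}(\mu^{(1)},\dots,\mu^{(N)})=[z^r]\sum_{\lambda\vdash d}\left(\frac{\dim\lambda}{d!}\right)^2\left(\prod_{i=1}^N\frac{\chi_\lambda(\mathcal{C}_{\mu^{(i)}})}{\dim\lambda}\right)\prod_{(i,j)\in Y_\lambda}G\bigl(z(j-i)\bigr),$$ where $[z^r]$ extracts the coefficient of $z^r$. The connected numbers $H_r^{G,\circ}$ are defined by inclusion-exclusion, i.e. by $$\sum_{r\geq0}\sum_{d\geq1}\sum_{\vec\mu}\widetilde H_r^{G,\circ}(\vec\mu)z^ry^dp_{\vec\mu}=\log\left(1+\sum_{r\geq0}\sum_{d\geq1}\sum_{\vec\mu}\widetilde H_r^{G,\bullet}(\vec\mu)z^ry^dp_{\vec\mu}\right),$$ where $\vec\mu$ ranges over $N$-tuples of partitions of $d$, $p_{\vec\mu}=\prod_{j=1}^N\prod_ip^{(j)}_{\mu^{(j)}_i}$ for independent formal variables $p^{(j)}_i$, and $\widetilde H_r(\vec\mu)=\bigl(\prod_{j=1}^N|\mathfrak{C}_{\mu^{(j)}}|\bigr)H_r(\vec\mu)$.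 $[\prod u_i^{a_i}\prod v_j^{b_j}]$ extracts the coefficient of the indicated monomial. $\bigl[\begin{smallmatrix}n\\k\end{smallmatrix}\bigr]$ is the unsigned Stirling number of the first kind (number of permutations of $n$ elements with exactly $k$ cycles) and $\bigl\{\begin{smallmatrix}n\\k\end{smallmatrix}\bigr\}$ the Stirling number of the second kind (number of set partitions of an $n$-element set into $k$ nonempty blocks). $A\sim B$ means $A/B\to1$ (when the right side vanishes identically, that the left side vanishes). *)

theory Defs
  imports
    Complex_Main
    "HOL-Library.Poly_Mapping"
    "HOL-Library.Function_Algebras"
    "HOL-Library.Landau_Symbols"
    "HOL-Library.Multiset"
    "HOL-Computational_Algebra.Formal_Power_Series"
    "HOL-Combinatorics.Combinatorics"
begin

definition partitions :: "nat \<Rightarrow> nat list set" where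
  "partitions d = {lam. sorted_wrt (\<ge>) lam \<and> 0 \<notin> set lam \<and> sum_list lam = d}"

definition young_diagram :: "nat list \<Rightarrow> (nat \<times> nat) set" where
  "young_diagram lam = {(i, j). 1 \<le> i \<and> i \<le> length lam \<and> 1 \<le> j \<and> j \<le> lam ! (i - 1)}"

definition cycle_type :: "nat \<Rightarrow> (nat \<Rightarrow> nat) \<Rightarrow> nat multiset" where
  "cycle_type d p = image_mset card (mset_set (orbit p ` {1..d}))"

definition conj_class :: "nat list \<Rightarrow> (nat \<Rightarrow> nat) set" where
  "conj_class mu = {p. p permutes {1..sum_list mu} \<and> cycle_type (sum_list mu) p = mset mu}"

text \<open>
  The irreducible complex representation of the symmetric group on \<open>{1..d}\<close> indexed by a
  partition \<open>lam\<close> of \<open>d\<close> is the left ideal of the group algebra generated by the Young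
  symmetrizer of the tableau of shape \<open>lam\<close> filled with \<open>1, \<dots>, d\<close> row by row. Thus the
  partition \<open>[d]\<close> gives the trivial representation.
  Elements of the group algebra are complex functions vanishing outside the group.
\<close>

definition row_reading :: "nat list \<Rightarrow> (nat \<times> nat) list" where
  "row_reading lam =
     concat (map (\<lambda>i. map (\<lambda>j. (i, j)) [1..<Suc (lam ! (i - 1))]) [1..<Suc (length lam)])"

definition box_of :: "nat list \<Rightarrow> nat \<Rightarrow> nat \<times> nat" where
  "box_of lam k = row_reading lam ! (k - 1)"

definition row_group :: "nat list \<Rightarrow> (nat \<Rightarrow> nat) set" where
  "row_group lam = {p. p permutes {1..sum_list lam} \<and>
     (\<forall>k\<in>{1..sum_list lam}. fst (box_of lam (p k)) = fst (box_of lam k))}"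

definition column_group :: "nat list \<Rightarrow> (nat \<Rightarrow> nat) set" where
  "column_group lam = {p. p permutes {1..sum_list lam} \<and>
     (\<forall>k\<in>{1..sum_list lam}. snd (box_of lam (p k)) = snd (box_of lam k))}"

definition group_algebra :: "nat \<Rightarrow> ((nat \<Rightarrow> nat) \<Rightarrow> complex) set" where
  "group_algebra d = {f. \<forall>p. \<not> p permutes {1..d} \<longrightarrow> f p = 0}"

definition galg_mult ::
  "nat \<Rightarrow> ((nat \<Rightarrow> nat) \<Rightarrow> complex) \<Rightarrow> ((nat \<Rightarrow> nat) \<Rightarrow> complex) \<Rightarrow> (nat \<Rightarrow> nat) \<Rightarrow> complex" where
  "galg_mult d f g = (\<lambda>p. \<Sum>s | s permutes {1..d}. f s * g (inv s \<circ> p))"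

definition young_symmetrizer :: "nat list \<Rightarrow> (nat \<Rightarrow> nat) \<Rightarrow> complex" where
  "young_symmetrizer lam = galg_mult (sum_list lam)
     (\<lambda>p. if p \<in> row_group lam then 1 else 0)
     (\<lambda>q. if q \<in> column_group lam then of_int (sign q) else 0)"

definition irrep :: "nat list \<Rightarrow> ((nat \<Rightarrow> nat) \<Rightarrow> complex) set" where
  "irrep lam =
     (\<lambda>f. galg_mult (sum_list lam) f (young_symmetrizer lam)) ` group_algebra (sum_list lam)"

definition left_act ::
  "(nat \<Rightarrow> nat) \<Rightarrow> ((nat \<Rightarrow> nat) \<Rightarrow> complex) \<Rightarrow> (nat \<Rightarrow> nat) \<Rightarrow> complex" where
  "left_act s f = (\<lambda>p. f (inv s \<circ> p))"

definition scale_fun :: "complex \<Rightarrow> ('b \<Rightarrow> complex) \<Rightarrow> 'b \<Rightarrow> complex" where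
  "scale_fun c f = (\<lambda>x. c * f x)"

global_interpretation cfun: vector_space scale_fun
  by unfold_locales (auto simp: scale_fun_def fun_eq_iff algebra_simps)

text \<open>
  The trace on a finite-dimensional invariant subspace \<open>W\<close>: the sum of the diagonal matrix
  entries with respect to any basis of \<open>W\<close>.
\<close>

definition trace_on :: "('b \<Rightarrow> complex) set \<Rightarrow> (('b \<Rightarrow> complex) \<Rightarrow> 'b \<Rightarrow> complex) \<Rightarrow> complex" where
  "trace_on W T = (let B = (SOME B. cfun.independent B \<and> cfun.span B = W)
                   in \<Sum>b\<in>B. cfun.representation B (T b) b)"

definition irrep_dim :: "nat list \<Rightarrow> nat" where
  "irrep_dim lam = cfun.dim (irrep lam)"

definition irr_char :: "nat list \<Rightarrow> nat list \<Rightarrow> complex" where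
  "irr_char lam mu = trace_on (irrep lam) (left_act (SOME s. s \<in> conj_class mu))"

text \<open>
  Hurwitz numbers take values in the ring of polynomials in the formal variables
  \<open>u\<^sub>i\<close> and \<open>v\<^sub>j\<close>; the weight \<open>G\<close> is a power series in \<open>z\<close> over that ring.
\<close>

datatype uv = U nat | V nat

type_synonym uv_poly = "(uv \<Rightarrow>\<^sub>0 nat) \<Rightarrow>\<^sub>0 complex"

definition const_uv :: "complex \<Rightarrow> uv_poly" where
  "const_uv c = Poly_Mapping.single 0 c"

definition var_uv :: "uv \<Rightarrow> uv_poly" where
  "var_uv x = Poly_Mapping.single (Poly_Mapping.single x 1) 1"

definition hurwitz_disconn :: "uv_poly fps \<Rightarrow> nat \<Rightarrow> nat list list \<Rightarrow> nat \<Rightarrow> uv_poly" where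
  "hurwitz_disconn G d mus r = fps_nth
     (\<Sum>lam\<in>partitions d.
        fps_const (const_uv ((of_nat (irrep_dim lam) / fact d)\<^sup>2 *
          (\<Prod>i<length mus. irr_char lam (mus ! i) / of_nat (irrep_dim lam)))) *
        (\<Prod>(i, j)\<in>young_diagram lam. G oo (fps_const (of_int (int j - int i)) * fps_X))) r"

text \<open>
  The generating series is a power series in \<open>y\<close> whose coefficients are polynomials in the
  variables \<open>p\<close>, indexed by pairs of a position in the tuple (counted from 0) and a part;
  the coefficients of these polynomials are power series in \<open>z\<close>.
\<close>

type_synonym p_poly = "((nat \<times> nat) \<Rightarrow>\<^sub>0 nat) \<Rightarrow>\<^sub>0 uv_poly fps"

definition p_exponent :: "nat list list \<Rightarrow> (nat \<times> nat) \<Rightarrow>\<^sub>0 nat" where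
  "p_exponent mus =
     (\<Sum>j<length mus. \<Sum>i<length (mus ! j). Poly_Mapping.single (j, mus ! j ! i) 1)"

definition class_factor :: "nat list list \<Rightarrow> complex" where
  "class_factor mus = (\<Prod>j<length mus. of_nat (card (conj_class (mus ! j))))"

definition disconn_series :: "uv_poly fps \<Rightarrow> nat \<Rightarrow> p_poly fps" where
  "disconn_series G N = Abs_fps (\<lambda>d. if d = 0 then 0 else
     (\<Sum>mus | length mus = N \<and> set mus \<subseteq> partitions d.
        Poly_Mapping.single (p_exponent mus)
          (Abs_fps (\<lambda>r. const_uv (class_factor mus) * hurwitz_disconn G d mus r))))"

definition log_one_plus :: "p_poly fps \<Rightarrow> p_poly fps" where
  "log_one_plus F =
     Abs_fps (\<lambda>n. Poly_Mapping.single 0 (fps_const (const_uv (fps_nth (fps_ln 1) n)))) oo F"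

definition hurwitz_conn :: "uv_poly fps \<Rightarrow> nat \<Rightarrow> nat list list \<Rightarrow> nat \<Rightarrow> uv_poly" where
  "hurwitz_conn G d mus r =
     const_uv (1 / class_factor mus) *
     fps_nth (Poly_Mapping.lookup
       (fps_nth (log_one_plus (disconn_series G (length mus))) d) (p_exponent mus)) r"

text \<open>
  The rational weight. The denominator has constant coefficient 1, hence it is invertible and
  \<open>fps_right_inverse\<close> started at 1 is its inverse (the coefficient ring is not a field, so
  \<open>inverse\<close> is not available).
\<close>

definition weight_num :: "nat \<Rightarrow> uv_poly fps" where
  "weight_num L = (\<Prod>i=1..L. 1 + fps_const (var_uv (U i)) * fps_X)"

definition weight_den :: "nat \<Rightarrow> nat \<Rightarrow> uv_poly fps" where
  "weight_den K n = (1 - fps_X) ^ K * (\<Prod>j=1..n. 1 - fps_const (var_uv (V j)) * fps_X)"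

definition rational_weight :: "nat \<Rightarrow> nat \<Rightarrow> nat \<Rightarrow> uv_poly fps" where
  "rational_weight K M L = weight_num L * fps_right_inverse (weight_den K (M - K)) 1"

lemma fps_prod_nth_zero: "fps_nth (prod f A) 0 = (\<Prod>x\<in>A. fps_nth (f x :: 'c::comm_ring_1 fps) 0)"
  by (induction A rule: infinite_finite_induct) simp_all

lemma rational_weight_eq: "rational_weight K M L * weight_den K (M - K) = weight_num L"
proof -
  have "fps_nth (weight_den K (M - K)) 0 = 1"
    by (simp add: weight_den_def fps_mult_nth_0 fps_nth_power_0 fps_prod_nth_zero)
  then have inv: "weight_den K (M - K) * fps_right_inverse (weight_den K (M - K)) 1 = 1"
    by (intro fps_right_inverse) simp
  have "rational_weight K M L * weight_den K (M - K) =
      weight_num L * (weight_den K (M - K) * fps_right_inverse (weight_den K (M - K)) 1)"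
    unfolding rational_weight_def by (simp only: ac_simps)
  then show ?thesis
    by (simp only: inv mult_1_right)
qed

end

theory Submission
  imports Defs "HOL-Analysis.Uniform_Limit"
begin

text \<open>
  The coefficient of a monomial in \<open>u\<close>, \<open>v\<close> in the content product of \<open>\<lambda>\<close> is, up to a power of \<open>z\<close>,
  a product of elementary and complete symmetric functions of the contents times
  \<open>\<Prod> (1 - c z) powi (-K)\<close>, the product being over the contents \<open>c\<close>. Contents \<open>\<plusminus>(d - 1)\<close> occur only for the
  shapes \<open>(d)\<close> and \<open>(1\<^sup>d)\<close>, whose representations are trivial and sign; for the prescribed parity of
  \<open>r\<close> these two contribute equally, whence the factor 2. All other shapes, and all products of
  lower-degree series coming from the logarithm, converge absolutely at \<open>z = 1 / (d - 3/2)\<close>, beyond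
  the pole \<open>1 / (d - 1)\<close>, and are exponentially smaller. The symmetric functions of
  \<open>0, \<dots>, d - 1\<close> are Stirling numbers. If some \<open>a\<^sub>i \<ge> d\<close>, the right-hand side vanishes, and so does the
  left-hand side, because a content product of size \<open>k\<close> has degree at most \<open>k - 1\<close> in \<open>u\<^sub>i\<close>.
\<close>

section \<open>Cycle types\<close>

text \<open>Formal variables must be removed before any limit is taken: a fixed monomial turns each
  content product into a complex power series. This extraction is not multiplicative, so the higher
  terms of the logarithm are never computed; they are only kept inside a class of series closed
  under sums and products and graded by the degree in \<open>y\<close>. Those terms involve only
  coefficients of \<open>y\<close>-degree below d, whose contents stay within d - 2. The radius 1 /
  (d - 3/2) lies beyond 1 / (d - 1), short of 1 / (d - 2) if d > 2, and is still positive at d = 2.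
  Parity: the column characters give the sign with exponent sum of d - length(mu), the reflection of
  z gives (-1)^r, and the exponents add up to 2 (g - 1 + d). The constant (d - 1)^(d - 2) / (d - 2)!
  is the value at the pole of the factors 1 / (1 - c z) with c < d - 1. Cycle types enter because
  the choice in \<open>irr_char\<close> and the division by \<open>class_factor\<close> require
  nonempty classes, and because the sign of a permutation must be read off from its number of
  cycles.\<close>

definition cycle_sizes :: "'a set \<Rightarrow> ('a \<Rightarrow> 'a) \<Rightarrow> nat multiset" where
  "cycle_sizes S p = image_mset card (mset_set (orbit p ` S))"

lemma orbit_least:
  assumes "f x \<in> A" and "\<And>y. y \<in> A \<Longrightarrow> f y \<in> A"
  shows "orbit f x \<subseteq> A"
proof
  fix y assume "y \<in> orbit f x"
  then show "y \<in> A" by induction (use assms in auto)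
qed

text \<open>The permutation \<open>p\<close> arises from \<open>q\<close> by inserting \<open>x\<close> right after \<open>y\<close> in the cycle of \<open>y\<close>.\<close>

locale cycle_extension =
  fixes q p :: "'a \<Rightarrow> 'a" and S :: "'a set" and x y :: 'a
  assumes q: "q permutes S" and fin: "finite S" and x: "x \<notin> S" and y: "y \<in> S"
  defines "p \<equiv> q \<circ> Transposition.transpose x y"
begin

lemma p_permutes: "p permutes insert x S"
  unfolding p_def using q y
  by (intro permutes_compose permutes_swap_id) (auto intro: permutes_subset)

lemma q_self: "z \<in> orbit q z"
  using q fin by (meson permutation_permutes permutation_self_in_orbit)

lemma p_self: "z \<in> orbit p z"
  using p_permutes fin by (meson finite.insertI permutation_permutes permutation_self_in_orbit)

lemma p_x: "p x = q y" and p_y: "p y = x"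
  using x q by (auto simp: p_def permutes_not_in)

lemma p_other: "z \<noteq> x \<Longrightarrow> z \<noteq> y \<Longrightarrow> p z = q z"
  by (simp add: p_def)

lemma orbit_sub: "z \<in> S \<Longrightarrow> orbit q z \<subseteq> S"
  using q by (rule permutes_orbit_subset)

text \<open>Both inclusions use minimality of orbits. The right-hand set is closed under
  \<open>p\<close>; conversely, dropping \<open>x\<close> from an orbit of \<open>p\<close> leaves a
  set closed under \<open>q\<close>, since the detour through \<open>x\<close> is skipped by q y = p
  (p y).\<close>

lemma orbit_p:
  assumes z: "z \<in> S"
  shows "orbit p z = (if y \<in> orbit q z then insert x (orbit q z) else orbit q z)"
proof
  let ?A = "if y \<in> orbit q z then insert x (orbit q z) else orbit q z"
  have step: "p w \<in> ?A" if "w \<in> ?A" for w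
  proof -
    consider "w = x" | "w = y" | "w \<noteq> x" "w \<noteq> y" by blast
    then show ?thesis
    proof cases
      case 1
      then have "y \<in> orbit q z" using that orbit_sub[OF z] x by (auto split: if_splits)
      then show ?thesis using 1 by (auto simp: p_x intro: orbit.step)
    next
      case 2
      then show ?thesis using that y x by (auto simp: p_y split: if_splits)
    next
      case 3
      then show ?thesis using that by (auto simp: p_other intro: orbit.step split: if_splits)
    qed
  qed
  show "orbit p z \<subseteq> ?A"
    by (rule orbit_least) (use step q_self in auto)
  have step': "q w \<in> orbit p z - {x}" if "w \<in> orbit p z" "w \<in> S" for w
  proof -
    have "q w \<in> S" using that q by (simp add: permutes_in_image)
    moreover have "q w \<in> orbit p z"
    proof (cases "w = y")
      case True
      then have "q w = p (p w)" by (simp add: p_x p_y)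
      then show ?thesis using that by (auto intro: orbit.step)
    next
      case False
      then have "q w = p w" using that x by (metis p_other)
      then show ?thesis using that by (auto intro: orbit.step)
    qed
    ultimately show ?thesis using x by auto
  qed
  have "orbit q z \<subseteq> (orbit p z - {x}) \<inter> S"
    by (rule orbit_least) (use step' z p_self q in \<open>auto simp: permutes_in_image\<close>)
  moreover have "x \<in> orbit p z" if "y \<in> orbit p z"
    using orbit.step[OF that] by (simp add: p_y)
  ultimately show "?A \<subseteq> orbit p z" by auto
qed

lemma orbit_p_x: "orbit p x = insert x (orbit q y)"
proof -
  have "orbit p y = insert x (orbit q y)"
    using orbit_p[OF y] q_self by simp
  moreover have "orbit p (p y) = orbit p y"
    using p_permutes fin by (metis finite.insertI permutation_orbit_step permutation_permutes)
  ultimately show ?thesis by (simp add: p_y)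
qed

lemma orbit_eq: "z \<in> S \<Longrightarrow> y \<in> orbit q z \<Longrightarrow> orbit q z = orbit q y"
  by (meson orbit_swap orbit_trans q_self subsetI subset_antisym)

lemma orbits_p: "orbit p ` insert x S = insert (insert x (orbit q y)) (orbit q ` S - {orbit q y})"
proof -
  have "orbit p z \<in> insert (insert x (orbit q y)) (orbit q ` S - {orbit q y})" if "z \<in> S" for z
    using orbit_p[OF that] orbit_eq[OF that] that q_self[of y] by auto
  moreover have "orbit q z \<in> orbit p ` S" if "z \<in> S" "orbit q z \<noteq> orbit q y" for z
    using orbit_p[OF that(1)] orbit_eq[OF that(1)] that by (metis image_eqI)
  ultimately show ?thesis
    unfolding image_insert orbit_p_x by auto
qed

text \<open>Only the cycle through \<open>y\<close> changes. As \<open>x\<close> lies outside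
  \<open>S\<close>, the enlarged orbit differs from all the others, so no two orbits merge in the
  set of orbits.\<close>

lemma cycle_sizes_p:
  "cycle_sizes (insert x S) p = add_mset (Suc (card (orbit q y))) (cycle_sizes S q - {#card (orbit q y)#})"
  and cycle_sizes_q: "card (orbit q y) \<in># cycle_sizes S q"
proof -
  let ?R = "orbit q ` S - {orbit q y}"
  have new: "insert x (orbit q y) \<notin> ?R" using orbit_sub x by auto
  have "finite (orbit q y)" using orbit_sub[OF y] fin finite_subset by auto
  then have card: "card (insert x (orbit q y)) = Suc (card (orbit q y))"
    using orbit_sub[OF y] x by (metis card_insert_disjoint in_mono)
  have eq: "orbit q ` S = insert (orbit q y) ?R" using y by auto
  have "mset_set (orbit q ` S) = add_mset (orbit q y) (mset_set ?R)"
    by (subst eq, subst mset_set.insert) (use fin in auto)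
  then have qs: "cycle_sizes S q = add_mset (card (orbit q y)) (image_mset card (mset_set ?R))"
    by (simp add: cycle_sizes_def)
  show "card (orbit q y) \<in># cycle_sizes S q" by (simp add: qs)
  show "cycle_sizes (insert x S) p = add_mset (Suc (card (orbit q y))) (cycle_sizes S q - {#card (orbit q y)#})"
    unfolding qs unfolding cycle_sizes_def orbits_p
    using new fin card by (subst mset_set.insert) auto
qed

lemma sign_p: "sign p = - sign q"
proof -
  have "permutation q" using q fin permutation_permutes by blast
  moreover have "x \<noteq> y" using x y by auto
  ultimately show ?thesis unfolding p_def
    by (simp add: sign_compose permutation_swap_id sign_swap_id)
qed

end

lemma cycle_sizes_fixpoint:
  assumes q: "q permutes S" and fin: "finite S" and x: "x \<notin> S"
  shows "cycle_sizes (insert x S) q = add_mset 1 (cycle_sizes S q)"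
proof -
  have "orbit q x = {x}" using q x by (simp add: orbit_eq_singleton_iff permutes_not_in)
  moreover have "{x} \<notin> orbit q ` S"
    using permutes_orbit_subset[OF q] x by fastforce
  ultimately show ?thesis using fin by (simp add: cycle_sizes_def)
qed

text \<open>Induction on the set, which is why \<open>cycle_sizes\<close> allows any finite set. A
  fixed point raises both the cardinality and the number of cycles; otherwise deleting
  \<open>x\<close> from its cycle keeps the number of cycles and flips the sign. The inequality is
  carried along to control the truncated subtraction.\<close>

lemma sign_cycle_sizes:
  assumes "finite S" "p permutes S"
  shows "size (cycle_sizes S p) \<le> card S \<and> sign p = (-1) ^ (card S - size (cycle_sizes S p))"
  using assms
proof (induction S arbitrary: p rule: finite_induct)
  case empty
  then show ?case by (simp add: cycle_sizes_def permutes_empty)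
next
  case (insert x S)
  show ?case
  proof (cases "p x = x")
    case True
    then have "p permutes S"
      using insert by (metis permutes_superset insertE Diff_iff insert_iff)
    then show ?thesis using insert cycle_sizes_fixpoint[of p S x] by simp
  next
    case False
    define y where "y = inv p x"
    \<comment> \<open>With y the preimage of \<open>x\<close>, this composition fixes
      \<open>x\<close> and sends y to p x: it cuts \<open>x\<close> out of its cycle.\<close>
    define q where "q = p \<circ> Transposition.transpose x y"
    have py: "p y = x" using insert.prems y_def permutes_inverses(1) by fastforce
    have yS: "y \<in> insert x S" using insert.prems py by (metis insertI1 permutes_in_image)
    then have "y \<in> S" using py False by auto
    have "q permutes insert x S" unfolding q_def using insert.prems yS
      by (intro permutes_compose permutes_swap_id) auto
    moreover have "q x = x" by (simp add: q_def py)
    ultimately have qS: "q permutes S"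
      by (metis permutes_superset insertE Diff_iff insert_iff)
    interpret cycle_extension q "q \<circ> Transposition.transpose x y" S x y
      using qS insert \<open>y \<in> S\<close> by unfold_locales auto
    have p: "p = q \<circ> Transposition.transpose x y" by (simp add: q_def comp_assoc)
    have "size (cycle_sizes (insert x S) p) = size (cycle_sizes S q)"
      using cycle_sizes_p cycle_sizes_q unfolding p[symmetric]
      by (simp add: size_Diff_singleton) (metis Suc_pred size_eq_0_iff_empty gr0I empty_iff set_mset_empty)
    then show ?thesis using insert.IH[OF qS] sign_p insert.hyps
      unfolding p[symmetric] by (auto simp: Suc_diff_le)
  qed
qed

text \<open>A part 1 becomes a fixed point; a larger part comes from lengthening a cycle that is one
  shorter by the new element.\<close>

lemma exists_cycle_sizes:
  assumes "finite S" "card S = sum_mset M" "0 \<notin># M"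
  shows "\<exists>p. p permutes S \<and> cycle_sizes S p = M"
  using assms
proof (induction S arbitrary: M rule: finite_induct)
  case empty
  then have "M = {#}" by (cases M) auto
  then show ?case by (auto simp: cycle_sizes_def intro!: exI[of _ id] permutes_id)
next
  case (insert x S)
  then obtain m M' where M: "M = add_mset m M'" by (cases M) auto
  show ?case
  proof (cases "m = 1")
    case True
    then obtain q where "q permutes S" "cycle_sizes S q = M'"
      using insert M by force
    then show ?thesis using cycle_sizes_fixpoint[of q S x] insert M True
      by (metis permutes_subset subset_insertI)
  next
    case False
    then obtain c where c: "m = Suc c" "c \<noteq> 0" using insert.prems M by (cases m) auto
    obtain q where qc: "q permutes S" "cycle_sizes S q = add_mset c M'"
      using insert.IH[of "add_mset c M'"] insert.prems insert.hyps M c by fastforce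
    then have "c \<in># cycle_sizes S q" by simp
    then obtain y where yc: "y \<in> S" "c = card (orbit q y)"
      using insert.hyps by (auto simp: cycle_sizes_def)
    interpret cycle_extension q "q \<circ> Transposition.transpose x y" S x y
      using qc insert yc by unfold_locales auto
    show ?thesis using p_permutes cycle_sizes_p unfolding yc(2)[symmetric] qc(2) M c by auto
  qed
qed

lemma cycle_type_cycle_sizes: "cycle_type d p = cycle_sizes {1..d} p"
  by (simp add: cycle_type_def cycle_sizes_def)

text \<open>Guarantees that the \<open>SOME\<close> in \<open>irr_char\<close> picks a real class
  representative and that \<open>class_factor\<close> can be divided by.\<close>

lemma conj_class_nonempty:
  assumes "mu \<in> partitions d"
  shows "conj_class mu \<noteq> {}"
  using assms exists_cycle_sizes[of "{1..d}" "mset mu"]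
  by (auto simp: partitions_def conj_class_def cycle_type_cycle_sizes sum_mset_sum_list)

lemma finite_conj_class: "finite (conj_class mu)"
  by (rule finite_subset[OF _ finite_permutations[of "{1..sum_list mu}"]]) (auto simp: conj_class_def)

lemma sign_conj_class:
  assumes "mu \<in> partitions d" "p \<in> conj_class mu"
  shows "p permutes {1..d}" "length mu \<le> d" "sign p = (-1) ^ (d - length mu)"
proof -
  show p: "p permutes {1..d}" using assms by (auto simp: partitions_def conj_class_def)
  have "size (cycle_sizes {1..d} p) = length mu"
    using assms by (auto simp: partitions_def conj_class_def cycle_type_cycle_sizes)
  then show "length mu \<le> d" "sign p = (-1) ^ (d - length mu)"
    using sign_cycle_sizes[OF _ p] by auto
qed

section \<open>The trivial and the sign representation\<close>

text \<open>The basis in \<open>trace_on\<close> is an arbitrary choice; every basis of a line is a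
  single nonzero vector, so the choice does not affect the trace.\<close>

lemma
  assumes b: "b \<noteq> 0" and W: "W = cfun.span {b}"
  shows dim_line: "cfun.dim W = 1"
    and trace_on_line: "(\<And>x. x \<in> W \<Longrightarrow> T x = scale_fun c x) \<Longrightarrow> trace_on W T = c"
proof -
  have ind: "cfun.independent {b}" using b by simp
  show dim: "cfun.dim W = 1"
    using cfun.dim_span_eq_card_independent[OF ind] W by simp
  assume T: "\<And>x. x \<in> W \<Longrightarrow> T x = scale_fun c x"
  define B where "B = (SOME B. cfun.independent B \<and> cfun.span B = W)"
  have B: "cfun.independent B \<and> cfun.span B = W"
    unfolding B_def by (rule someI[of _ "{b}"]) (use ind W in auto)
  then have "card B = 1"
    using dim cfun.dim_span_eq_card_independent[of B] by simp
  then obtain b' where b': "B = {b'}" by (auto simp: card_1_singleton_iff)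
  have "cfun.representation B (T b') b' = c"
    using B T[of b'] by (auto simp: b' cfun.representation_scale cfun.representation_basis cfun.span_base)
  then show "trace_on W T = c"
    by (simp add: trace_on_def B_def[symmetric] b')
qed

lemma permutes_comp_inv_iff:
  assumes "s permutes A"
  shows "inv s \<circ> p permutes A \<longleftrightarrow> p permutes A"
proof
  assume "inv s \<circ> p permutes A"
  then have "s \<circ> (inv s \<circ> p) permutes A" using assms by (rule permutes_compose)
  then show "p permutes A" using assms by (simp add: o_assoc permutes_inv_o)
qed (use assms in \<open>simp add: permutes_compose permutes_inv\<close>)

text \<open>Common setting for the trivial and the sign representation: the Young symmetrizer is
  itself a linear character extended by 0, so translations multiply it by scalars. Together with the
  other axioms, \<open>chi_inv\<close> forces the values to be 1 or -1.\<close>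

locale linear_character =
  fixes lam :: "nat list" and d :: nat and chi :: "(nat \<Rightarrow> nat) \<Rightarrow> complex"
  assumes sum_lam: "sum_list lam = d"
    and ysym: "young_symmetrizer lam = (\<lambda>p. if p permutes {1..d} then chi p else 0)"
    and chi_comp: "\<And>p q. p permutes {1..d} \<Longrightarrow> q permutes {1..d} \<Longrightarrow> chi (p \<circ> q) = chi p * chi q"
    and chi_inv: "\<And>p. p permutes {1..d} \<Longrightarrow> chi (inv p) = chi p"
    and chi_id: "chi id = 1"
begin

abbreviation "Y \<equiv> young_symmetrizer lam"

lemma Y_comp_inv: "s permutes {1..d} \<Longrightarrow> Y (inv s \<circ> p) = chi s * Y p"
  using permutes_comp_inv_iff[of s "{1..d}" p]
  by (simp add: ysym chi_comp chi_inv permutes_inv)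

lemma Y_nonzero: "Y \<noteq> 0"
proof
  assume "Y = 0"
  then have "Y id = 0" by simp
  then show False using permutes_id[of "{1..d}"] by (simp add: ysym chi_id)
qed

text \<open>Convolving f with \<open>Y\<close> gives the scalar sum of f(s) chi(s) times
  \<open>Y\<close>, and functions supported at the identity already produce every scalar.\<close>

lemma irrep_eq: "irrep lam = cfun.span {Y}"
proof -
  have eq: "galg_mult d f Y = scale_fun (\<Sum>s | s permutes {1..d}. f s * chi s) Y" for f
    by (auto simp: galg_mult_def scale_fun_def fun_eq_iff sum_distrib_right Y_comp_inv mult.assoc intro!: sum.cong)
  have "scale_fun c Y \<in> (\<lambda>f. galg_mult d f Y) ` group_algebra d" for c
  proof (rule image_eqI)
    let ?f = "\<lambda>p. if p = id then c else 0"
    show "?f \<in> group_algebra d" by (auto simp: group_algebra_def permutes_id)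
    have "(\<Sum>s | s permutes {1..d}. ?f s * chi s) = (\<Sum>s | s permutes {1..d}. if s = id then c else 0)"
      by (rule sum.cong) (auto simp: chi_id)
    also have "\<dots> = c"
      using permutes_id[of "{1..d}"] finite_permutations[of "{1..d}"] by (simp add: sum.delta)
    finally show "scale_fun c Y = galg_mult d ?f Y" by (simp add: eq)
  qed
  then show ?thesis
    by (auto simp: irrep_def sum_lam cfun.span_singleton eq)
qed

lemma irrep_dim_eq_1: "irrep_dim lam = 1"
  unfolding irrep_dim_def by (rule dim_line[OF Y_nonzero irrep_eq])

lemma irr_char_eq:
  assumes "mu \<in> partitions d" and c: "\<And>s. s \<in> conj_class mu \<Longrightarrow> chi s = c"
  shows "irr_char lam mu = c"
proof -
  define s where "s = (SOME s. s \<in> conj_class mu)"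
  have s: "s \<in> conj_class mu"
    unfolding s_def using conj_class_nonempty[OF assms(1)] some_in_eq by blast
  have "left_act s x = scale_fun c x" if x: "x \<in> irrep lam" for x
  proof -
    obtain k where "x = scale_fun k Y" using x by (auto simp: irrep_eq cfun.span_singleton)
    then show ?thesis using Y_comp_inv[OF sign_conj_class(1)[OF assms(1) s]] c[OF s]
      by (auto simp: left_act_def scale_fun_def)
  qed
  then show ?thesis unfolding irr_char_def s_def[symmetric]
    by (rule trace_on_line[OF Y_nonzero irrep_eq])
qed

end

lemma box_of_row:
  assumes "k \<in> {1..d}" shows "box_of [d] k = (1, k)"
proof -
  have "[1..<Suc (length [d])] = [1]" by simp
  then have "row_reading [d] = map (\<lambda>j. (1, j)) [1..<Suc d]"
    unfolding row_reading_def by (simp del: upt_Suc)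
  then show ?thesis using assms by (auto simp: box_of_def simp del: upt_Suc)
qed

lemma box_of_column:
  assumes "k \<in> {1..d}" shows "box_of (replicate d 1) k = (k, 1)"
proof -
  have "row_reading (replicate d 1) = concat (map (\<lambda>i. [(i, 1)]) [1..<Suc d])"
    unfolding row_reading_def by (intro arg_cong[of _ _ concat] map_cong) auto
  also have "\<dots> = map (\<lambda>i. (i, 1)) [1..<Suc d]"
    by (simp only: concat_map_singleton)
  finally show ?thesis using assms by (auto simp: box_of_def simp del: upt_Suc)
qed

lemma permutes_fixing_all: "{p. p permutes A \<and> (\<forall>k\<in>A. p k = k)} = {id}"
proof -
  have "p = id" if "p permutes A" "\<forall>k\<in>A. p k = k" for p
    using that by (metis eq_id_iff permutes_not_in)
  then show ?thesis using permutes_id[of A] by auto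
qed

lemma row_group_row: "row_group [d] = {p. p permutes {1..d}}"
  unfolding row_group_def by (force simp: box_of_row simp flip: atLeastAtMost_iff dest: permutes_in_image)

lemma column_group_column: "column_group (replicate d 1) = {p. p permutes {1..d}}"
proof -
  have "\<forall>k\<in>{1..d}. snd (box_of (replicate d 1) (p k)) = snd (box_of (replicate d 1) k)"
    if "p permutes {1..d}" for p
    using that by (metis box_of_column permutes_in_image snd_conv)
  then show ?thesis by (auto simp: column_group_def sum_list_replicate)
qed

lemma column_group_row: "column_group [d] = {id}"
proof -
  have "column_group [d] = {p. p permutes {1..d} \<and> (\<forall>k\<in>{1..d}. p k = k)}"
    unfolding column_group_def
    by (intro Collect_cong conj_cong ball_cong) (simp_all add: box_of_row permutes_in_image del: atLeastAtMost_iff)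
  then show ?thesis by (simp only: permutes_fixing_all)
qed

lemma row_group_column: "row_group (replicate d 1) = {id}"
proof -
  have "row_group (replicate d 1) = {p. p permutes {1..d} \<and> (\<forall>k\<in>{1..d}. p k = k)}"
    unfolding row_group_def
    by (intro Collect_cong conj_cong ball_cong)
      (simp_all add: sum_list_replicate box_of_column[unfolded One_nat_def] box_of_column permutes_in_image del: atLeastAtMost_iff)
  then show ?thesis by (simp only: permutes_fixing_all)
qed

text \<open>The column group is trivial, so the convolution at p retains only the term s = p, with
  value 1.\<close>

interpretation trivial_rep: linear_character "[d]" d "\<lambda>_. 1"
proof
  have inv: "inv s \<circ> p = id \<longleftrightarrow> s = p" if "s permutes {1..d}" for s p :: "nat \<Rightarrow> nat"
    using that by (metis comp_assoc comp_id id_comp permutes_inv_o)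
  have "young_symmetrizer [d] p = (\<Sum>s | s permutes {1..d}. if s = p then 1 else 0)" for p
    unfolding young_symmetrizer_def galg_mult_def row_group_row column_group_row
    by (simp, intro sum.cong refl) (auto simp: inv sign_id permutes_inv_o)
  then show "young_symmetrizer [d] = (\<lambda>p. if p permutes {1..d} then 1 else 0)"
    by (intro ext) (simp add: finite_permutations del: fun_eq_iff)
qed auto

text \<open>Dual situation: the row group is trivial, so only s = id contributes, with value the
  sign of p.\<close>

interpretation sign_rep: linear_character "replicate d 1" d "\<lambda>p. of_int (sign p)"
proof
  have "young_symmetrizer (replicate d 1) p =
      (\<Sum>s | s permutes {1..d}. if s = id then if p permutes {1..d} then of_int (sign p) else 0 else 0)" for p
    unfolding young_symmetrizer_def galg_mult_def row_group_column column_group_column sum_list_replicate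
    by (intro sum.cong) auto
  then show "young_symmetrizer (replicate d 1) = (\<lambda>p. if p permutes {1..d} then of_int (sign p) else 0)"
    using permutes_id[of "{1..d}"] finite_permutations[of "{1..d}"]
    by (intro ext) simp
next
  fix p q :: "nat \<Rightarrow> nat" assume "p permutes {1..d}" "q permutes {1..d}"
  then have "permutation p" "permutation q" using permutation_permutes by blast+
  then show "(of_int (sign (p \<circ> q)) :: complex) = of_int (sign p) * of_int (sign q)"
    and "(of_int (sign (inv p)) :: complex) = of_int (sign p)"
    by (simp_all add: sign_compose sign_inverse)
qed (auto simp: sum_list_replicate sign_id)

lemma irr_char_row: "mu \<in> partitions d \<Longrightarrow> irr_char [d] mu = 1"
  by (rule trivial_rep.irr_char_eq) simp_all

lemma irr_char_column: "mu \<in> partitions d \<Longrightarrow> irr_char (replicate d 1) mu = (-1) ^ (d - length mu)"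
  by (rule sign_rep.irr_char_eq) (simp_all add: sign_conj_class(3))

lemmas irrep_dim_row = trivial_rep.irrep_dim_eq_1
lemmas irrep_dim_column = sign_rep.irrep_dim_eq_1

section \<open>Coefficients of content products\<close>

abbreviation (input) lookup :: "('a \<Rightarrow>\<^sub>0 'b::zero) \<Rightarrow> 'a \<Rightarrow> 'b" where
  "lookup \<equiv> Poly_Mapping.lookup"

lemma const_uv_0 [simp]: "const_uv 0 = 0"
  and const_uv_1 [simp]: "const_uv 1 = 1"
  and const_uv_add: "const_uv (a + b) = const_uv a + const_uv b"
  and const_uv_minus: "const_uv (- a) = - const_uv a"
  and const_uv_mult: "const_uv (a * b) = const_uv a * const_uv b"
  by (simp_all add: const_uv_def single_add mult_single single_uminus)

lemma const_uv_sum: "const_uv (sum f A) = (\<Sum>x\<in>A. const_uv (f x))"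
  by (induction A rule: infinite_finite_induct) (simp_all add: const_uv_add)

lemma const_uv_power: "const_uv (a ^ n) = const_uv a ^ n"
  by (induction n) (simp_all add: const_uv_mult)

lemma const_uv_of_nat: "const_uv (of_nat n) = of_nat n"
  by (induction n) (simp_all add: const_uv_add)

lemma const_uv_of_int: "const_uv (of_int n) = of_int n"
  by (cases n rule: int_diff_cases) (simp add: const_uv_add const_uv_minus const_uv_of_nat flip: add_uminus_conv_diff)

definition splits :: "('a \<Rightarrow>\<^sub>0 nat) \<Rightarrow> (('a \<Rightarrow>\<^sub>0 nat) \<times> ('a \<Rightarrow>\<^sub>0 nat)) set" where
  "splits e = {(e1, e2). e = e1 + e2}"

text \<open>The first summand is bounded pointwise by \<open>e\<close>, hence supported on its keys,
  and it determines the second one by cancellation.\<close>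

lemma finite_splits: "finite (splits e)"
proof -
  let ?B = "\<Union>x\<in>Poly_Mapping.keys e. {..lookup e x}"
  let ?F = "{f. \<forall>x. (x \<in> Poly_Mapping.keys e \<longrightarrow> f x \<in> ?B) \<and> (x \<notin> Poly_Mapping.keys e \<longrightarrow> f x = 0)}"
  have "finite ?F" by (rule finite_set_of_finite_funs) auto
  moreover have "(lookup \<circ> fst) ` splits e \<subseteq> ?F"
    by (fastforce simp: splits_def lookup_add in_keys_iff)
  ultimately have "finite ((lookup \<circ> fst) ` splits e)" by (rule rev_finite_subset)
  moreover have "inj_on (lookup \<circ> fst) (splits e)"
    by (auto simp: inj_on_def splits_def poly_mapping_eqI)
  ultimately show ?thesis by (rule finite_imageD)
qed

lemma lookup_mult_splits:
  "lookup (p * q) e = (\<Sum>(e1, e2)\<in>splits e. lookup p e1 * lookup q e2)"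
proof -
  have "lookup (p * q) e = (\<Sum>(a, b). lookup p a * lookup q b when e = a + b)"
    unfolding times_poly_mapping.rep_eq by (rule prod_fun_unfold_prod) simp_all
  also have "\<dots> = (\<Sum>x\<in>splits e. case x of (a, b) \<Rightarrow> lookup p a * lookup q b when e = a + b)"
    by (rule Sum_any.expand_superset[OF finite_splits]) (auto simp: splits_def)
  also have "\<dots> = (\<Sum>(e1, e2)\<in>splits e. lookup p e1 * lookup q e2)"
    by (rule sum.cong) (auto simp: splits_def)
  finally show ?thesis .
qed

lemma lookup_single_mult:
  "lookup (Poly_Mapping.single 0 c * p) e = c * lookup (p :: ('a \<Rightarrow>\<^sub>0 nat) \<Rightarrow>\<^sub>0 'b::semiring_0) e"
proof -
  have "lookup (Poly_Mapping.single 0 c * p) e = (\<Sum>x\<in>splits e. if x = (0, e) then c * lookup p e else 0)"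
    unfolding lookup_mult_splits by (rule sum.cong) (auto simp: lookup_single when_def splits_def split: if_splits)
  also have "\<dots> = c * lookup p e" using finite_splits[of e] by (simp add: sum.delta splits_def)
  finally show ?thesis .
qed

lemma lookup_const_uv_mult: "lookup (const_uv c * p) e = c * lookup p e"
  unfolding const_uv_def by (rule lookup_single_mult)

lemma lookup_sum: "lookup (sum f A) e = (\<Sum>x\<in>A. lookup (f x) e)"
  by (induction A rule: infinite_finite_induct) (simp_all add: lookup_add)

text \<open>Bridge from formal series over the polynomial ring to complex series, where convergence
  makes sense.\<close>

definition coeff_series :: "(uv \<Rightarrow>\<^sub>0 nat) \<Rightarrow> uv_poly fps \<Rightarrow> complex fps" where
  "coeff_series e f = Abs_fps (\<lambda>r. lookup (fps_nth f r) e)"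

lemma coeff_series_0 [simp]: "coeff_series e 0 = 0"
  and coeff_series_add: "coeff_series e (f + g) = coeff_series e f + coeff_series e g"
  and coeff_series_scale: "coeff_series e (fps_const (const_uv c) * f) = fps_const c * coeff_series e f"
  by (simp_all add: coeff_series_def fps_eq_iff lookup_add lookup_const_uv_mult)

lemma coeff_series_sum: "coeff_series e (sum f A) = (\<Sum>x\<in>A. coeff_series e (f x))"
  by (induction A rule: infinite_finite_induct) (simp_all add: coeff_series_add)

text \<open>The monomial may be shared between the two factors in any way, so extraction obeys a
  convolution rule.\<close>

lemma coeff_series_mult:
  "coeff_series e (f * g) = (\<Sum>(e1, e2)\<in>splits e. coeff_series e1 f * coeff_series e2 g)"
proof (rule fps_ext)
  fix r
  have "fps_nth (coeff_series e (f * g)) r =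
      (\<Sum>i=0..r. \<Sum>x\<in>splits e. lookup (fps_nth f i) (fst x) * lookup (fps_nth g (r - i)) (snd x))"
    by (simp add: coeff_series_def fps_mult_nth lookup_sum lookup_mult_splits split_beta)
  also have "\<dots> = (\<Sum>x\<in>splits e. \<Sum>i=0..r. lookup (fps_nth f i) (fst x) * lookup (fps_nth g (r - i)) (snd x))"
    by (rule sum.swap)
  also have "\<dots> = fps_nth (\<Sum>(e1, e2)\<in>splits e. coeff_series e1 f * coeff_series e2 g) r"
    by (simp add: fps_sum_nth fps_mult_nth coeff_series_def split_beta)
  finally show "fps_nth (coeff_series e (f * g)) r = \<dots>" .
qed

text \<open>The ring homomorphism f(z) -> f(x z) from complex series; x = 1 gives the plain
  embedding, used for the K denominator factors without a variable.\<close>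

definition subst_series :: "uv_poly \<Rightarrow> complex fps \<Rightarrow> uv_poly fps" where
  "subst_series x f = Abs_fps (\<lambda>n. const_uv (fps_nth f n) * x ^ n)"

lemma subst_series_1 [simp]: "subst_series x 1 = 1"
  by (auto simp: subst_series_def fps_eq_iff)

lemma subst_series_mult: "subst_series x (f * g) = subst_series x f * subst_series x g"
proof (rule fps_ext)
  fix n
  have "const_uv (fps_nth f i * fps_nth g (n - i)) * x ^ n =
      (const_uv (fps_nth f i) * x ^ i) * (const_uv (fps_nth g (n - i)) * x ^ (n - i))" if "i \<le> n" for i
    using that power_add[of x i "n - i"] by (simp add: const_uv_mult ac_simps)
  then show "fps_nth (subst_series x (f * g)) n = fps_nth (subst_series x f * subst_series x g) n"
    by (simp add: subst_series_def fps_mult_nth const_uv_sum sum_distrib_right)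
qed

lemma subst_series_power: "subst_series x (f ^ n) = subst_series x f ^ n"
  by (induction n) (simp_all add: subst_series_mult)

text \<open>Coefficient form of f(z) -> f(c z). It replaces composition with a multiple of
  \<open>fps_X\<close>, so that contents act by a multiplicative map.\<close>

definition dilate :: "'a::comm_ring_1 \<Rightarrow> 'a fps \<Rightarrow> 'a fps" where
  "dilate c f = Abs_fps (\<lambda>n. c ^ n * fps_nth f n)"

lemma dilate_1 [simp]: "dilate c 1 = 1"
  by (auto simp: dilate_def fps_eq_iff)

lemma dilate_mult: "dilate c (f * g) = dilate c f * dilate c g"
proof (rule fps_ext)
  fix n
  have "c ^ n * (fps_nth f i * fps_nth g (n - i)) = (c ^ i * fps_nth f i) * (c ^ (n - i) * fps_nth g (n - i))"
    if "i \<le> n" for i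
    using power_add[of c i "n - i"] that by (simp add: algebra_simps)
  then show "fps_nth (dilate c (f * g)) n = fps_nth (dilate c f * dilate c g) n"
    by (simp add: dilate_def fps_mult_nth sum_distrib_left)
qed

lemma dilate_power: "dilate c (f ^ n) = dilate c f ^ n"
  by (induction n) (simp_all add: dilate_mult)

lemma dilate_prod: "dilate c (prod f A) = (\<Prod>a\<in>A. dilate c (f a))"
  by (induction A rule: infinite_finite_induct) (simp_all add: dilate_mult)

lemma dilate_subst_series: "dilate (const_uv c) (subst_series x f) = subst_series x (dilate c f)"
  by (simp add: dilate_def subst_series_def fps_eq_iff const_uv_mult const_uv_power mult.assoc)

section \<open>Factorization of the weight and of content products\<close>

definition linear_series :: "complex \<Rightarrow> complex fps" where
  "linear_series c = 1 + fps_const c * fps_X"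

definition geometric_series :: "complex \<Rightarrow> complex fps" where
  "geometric_series c = Abs_fps (\<lambda>n. c ^ n)"

lemma dilate_linear_series: "dilate c (linear_series b) = linear_series (c * b)"
  and dilate_geometric: "dilate c (geometric_series b) = geometric_series (c * b)"
  by (auto simp: dilate_def linear_series_def geometric_series_def fps_eq_iff power_mult_distrib le_Suc_eq)

lemma linear_times_geometric: "linear_series (- c) * geometric_series c = 1"
proof (rule fps_ext)
  fix n
  show "fps_nth (linear_series (- c) * geometric_series c) n = fps_nth 1 n"
    by (cases n) (simp_all add: linear_series_def geometric_series_def distrib_right mult.assoc)
qed

lemma subst_series_linear: "subst_series x (linear_series c) = 1 + fps_const (const_uv c * x) * fps_X"
proof (rule fps_ext)
  fix n
  show "fps_nth (subst_series x (linear_series c)) n = fps_nth (1 + fps_const (const_uv c * x) * fps_X) n"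
    by (auto simp: subst_series_def linear_series_def le_Suc_eq)
qed


text \<open>The formal inverse is never unfolded: the product of geometric series inverts the
  denominator, and multiplying \<open>rational_weight_eq\<close> by it leaves the explicit
  product.\<close>

lemma rational_weight_factors:
  "rational_weight K M L =
     (\<Prod>i=1..L. subst_series (var_uv (U i)) (linear_series 1)) * subst_series 1 (geometric_series 1) ^ K *
     (\<Prod>j=1..M-K. subst_series (var_uv (V j)) (geometric_series 1))"
proof -
  let ?D = "weight_den K (M - K)"
  let ?I = "subst_series 1 (geometric_series 1) ^ K * (\<Prod>j=1..M-K. subst_series (var_uv (V j)) (geometric_series 1))"
  have den: "?D = subst_series 1 (linear_series (- 1)) ^ K * (\<Prod>j=1..M-K. subst_series (var_uv (V j)) (linear_series (-1)))"
    by (simp add: weight_den_def subst_series_linear const_uv_minus fps_const_neg [symmetric] del: fps_const_neg)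
  have inv: "subst_series x (linear_series (-1)) * subst_series x (geometric_series 1) = 1" for x
    using linear_times_geometric[of 1] by (simp flip: subst_series_mult)
  have "?D * ?I = (subst_series 1 (linear_series (-1)) * subst_series 1 (geometric_series 1)) ^ K *
      (\<Prod>j=1..M-K. subst_series (var_uv (V j)) (linear_series (-1)) * subst_series (var_uv (V j)) (geometric_series 1))"
    unfolding den by (simp only: power_mult_distrib prod.distrib ac_simps)
  also have "\<dots> = 1" by (simp add: inv)
  finally have DI: "?D * ?I = 1" .
  have "rational_weight K M L = rational_weight K M L * (?D * ?I)" by (simp only: DI mult_1_right)
  also have "\<dots> = weight_num L * ?I" by (simp add: rational_weight_eq flip: mult.assoc)
  also have "weight_num L = (\<Prod>i=1..L. subst_series (var_uv (U i)) (linear_series 1))"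
    by (simp add: weight_num_def subst_series_linear)
  finally show ?thesis by (simp add: mult.assoc)
qed

text \<open>Generating function of the elementary symmetric functions of the contents;
  \<open>content_geometric\<close> is the one for the complete symmetric functions.\<close>

definition content_linear :: "int multiset \<Rightarrow> complex fps" where
  "content_linear C = prod_mset (image_mset (\<lambda>c. linear_series (of_int c)) C)"

definition content_geometric :: "int multiset \<Rightarrow> complex fps" where
  "content_geometric C = prod_mset (image_mset (\<lambda>c. geometric_series (of_int c)) C)"

text \<open>Taking a multiset rather than a diagram permits induction one content at a time and
  expresses transposition as negation of the contents.\<close>

definition content_product :: "uv_poly fps \<Rightarrow> int multiset \<Rightarrow> uv_poly fps" where
  "content_product G C = prod_mset (image_mset (\<lambda>c. G oo (fps_const (of_int c) * fps_X)) C)"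

text \<open>A single index set for numerator and denominator variables, so that both are extracted
  by one induction.\<close>

definition weight_vars :: "nat \<Rightarrow> nat \<Rightarrow> uv set" where
  "weight_vars L n = U ` {1..L} \<union> V ` {1..n}"

lemma prod_weight_vars:
  "(\<Prod>t\<in>weight_vars L n. f t) = (\<Prod>i=1..L. f (U i)) * (\<Prod>j=1..n. f (V j) :: 'a::comm_monoid_mult)"
  unfolding weight_vars_def
  by (subst prod.union_disjoint) (auto simp: prod.reindex inj_on_def)

lemma sum_weight_vars:
  "(\<Sum>t\<in>weight_vars L n. f t) = (\<Sum>i=1..L. f (U i)) + (\<Sum>j=1..n. f (V j) :: 'a::comm_monoid_add)"
  unfolding weight_vars_def
  by (subst sum.union_disjoint) (auto simp: sum.reindex inj_on_def)

text \<open>Each box dilates every factor of the weight; regrouping by variable instead of by box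
  leaves each formal variable in exactly one factor.\<close>

lemma content_product_factors:
  "content_product (rational_weight K M L) C = subst_series 1 (content_geometric C ^ K) *
     (\<Prod>t\<in>weight_vars L (M - K). subst_series (var_uv t)
        (case t of U i \<Rightarrow> content_linear C | V j \<Rightarrow> content_geometric C))"
proof (induction C)
  case empty
  have "(case t of U i \<Rightarrow> content_linear {#} | V j \<Rightarrow> content_geometric {#}) = 1" for t
    by (cases t) (simp_all add: content_linear_def content_geometric_def)
  then show ?case by (simp add: content_product_def content_geometric_def)
next
  case (add c C)
  have "rational_weight K M L oo (fps_const (of_int c) * fps_X) = dilate (const_uv (of_int c)) (rational_weight K M L)"
    by (simp add: fps_compose_linear dilate_def const_uv_of_int)
  also have "\<dots> = subst_series 1 (geometric_series (of_int c) ^ K) *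
     (\<Prod>t\<in>weight_vars L (M - K). subst_series (var_uv t)
        (case t of U i \<Rightarrow> linear_series (of_int c) | V j \<Rightarrow> geometric_series (of_int c)))"
    unfolding rational_weight_factors
    by (simp add: dilate_mult dilate_power dilate_prod dilate_subst_series dilate_linear_series dilate_geometric
        prod_weight_vars subst_series_power ac_simps)
  finally show ?case using add
    by (simp add: content_product_def content_linear_def content_geometric_def prod_weight_vars
        power_mult_distrib subst_series_mult prod.distrib ac_simps)
qed

lemma var_uv_power: "var_uv t ^ n = Poly_Mapping.single (Poly_Mapping.single t n) 1"
  by (induction n) (simp_all add: var_uv_def mult_single flip: single_add)

text \<open>In h(t z) the powers of t and z agree, so fixing the power of t leaves a single power of
  z. The condition says that \<open>e\<close> involves no variable besides \<open>t\<close>.\<close>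

lemma coeff_series_subst_var:
  "coeff_series e (subst_series (var_uv t) h) =
     (if e = Poly_Mapping.single t (lookup e t) then fps_const (fps_nth h (lookup e t)) * fps_X ^ lookup e t else 0)"
proof (rule fps_ext)
  fix r
  have "fps_nth (coeff_series e (subst_series (var_uv t) h)) r = (if Poly_Mapping.single t r = e then fps_nth h r else 0)"
    by (simp add: coeff_series_def subst_series_def var_uv_power lookup_const_uv_mult lookup_single when_def)
  then show "fps_nth (coeff_series e (subst_series (var_uv t) h)) r =
    fps_nth (if e = Poly_Mapping.single t (lookup e t) then fps_const (fps_nth h (lookup e t)) * fps_X ^ lookup e t else 0) r"
    by (auto simp: lookup_single)
qed

lemma coeff_series_subst_1_mult: "coeff_series e (subst_series 1 h * f) = h * coeff_series e f"
  by (simp add: coeff_series_def subst_series_def fps_eq_iff fps_mult_nth lookup_sum lookup_const_uv_mult)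

text \<open>The factors involve distinct variables, so of all the ways to split \<open>e\<close>
  only one survives: the \<open>t\<close>-part \<open>?e1\<close> against the rest
  \<open>?e2\<close>.\<close>

lemma coeff_series_prod_subst_var:
  assumes "finite T"
  shows "coeff_series e (\<Prod>t\<in>T. subst_series (var_uv t) (h t)) =
    (if Poly_Mapping.keys e \<subseteq> T
     then fps_const (\<Prod>t\<in>T. fps_nth (h t) (lookup e t)) * fps_X ^ (\<Sum>t\<in>T. lookup e t) else 0)"
  using assms
proof (induction T arbitrary: e rule: finite_induct)
  case empty
  have "coeff_series e 1 = (if e = 0 then 1 else 0)"
    by (auto simp: coeff_series_def fps_eq_iff lookup_one when_def)
  then show ?case by simp
next
  case (insert t T)
  let ?F = "\<Prod>t\<in>T. subst_series (var_uv t) (h t)"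
  let ?n = "lookup e t"
  let ?e1 = "Poly_Mapping.single t ?n"
  let ?e2 = "e - ?e1"
  have split: "(?e1, ?e2) \<in> splits e"
    by (auto simp: splits_def lookup_add lookup_minus lookup_single when_def intro!: poly_mapping_eqI)
  have zero: "coeff_series e1 (subst_series (var_uv t) (h t)) * coeff_series e2 ?F = 0"
    if "(e1, e2) \<in> splits e" "(e1, e2) \<noteq> (?e1, ?e2)" for e1 e2
  proof (rule ccontr)
    assume "\<not> ?thesis"
    then have 1: "e1 = Poly_Mapping.single t (lookup e1 t)" and 2: "Poly_Mapping.keys e2 \<subseteq> T"
      by (auto simp: coeff_series_subst_var insert.IH split: if_splits)
    then have "lookup e2 t = 0" using insert.hyps by (auto simp: in_keys_iff)
    then have "lookup e1 t = ?n" using that(1) by (simp add: splits_def lookup_add)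
    then have "e1 = ?e1" using 1 by simp
    moreover have "e2 = e - e1" using that(1) by (simp add: splits_def)
    ultimately show False using that(2) by metis
  qed
  have keys: "Poly_Mapping.keys ?e2 \<subseteq> T \<longleftrightarrow> Poly_Mapping.keys e \<subseteq> insert t T"
    using insert.hyps by (auto simp: in_keys_iff subset_iff lookup_minus lookup_single when_def)
  have look: "lookup ?e2 s = lookup e s" if "s \<in> T" for s
    using that insert.hyps by (auto simp: lookup_minus lookup_single when_def)
  have "coeff_series e (\<Prod>t\<in>insert t T. subst_series (var_uv t) (h t)) =
      (\<Sum>(e1, e2)\<in>splits e. coeff_series e1 (subst_series (var_uv t) (h t)) * coeff_series e2 ?F)"
    using insert.hyps by (simp add: coeff_series_mult)
  also have "\<dots> = (\<Sum>(e1, e2)\<in>{(?e1, ?e2)}. coeff_series e1 (subst_series (var_uv t) (h t)) * coeff_series e2 ?F)"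
    by (rule sum.mono_neutral_right) (use split zero finite_splits in \<open>auto simp del: mult_eq_0_iff\<close>)
  also have "\<dots> = coeff_series ?e1 (subst_series (var_uv t) (h t)) * coeff_series ?e2 ?F" by simp
  also have "coeff_series ?e1 (subst_series (var_uv t) (h t)) = fps_const (fps_nth (h t) ?n) * fps_X ^ ?n"
    by (subst coeff_series_subst_var) (simp add: lookup_single)
  finally show ?case using insert.hyps
    by (simp add: insert.IH keys look power_add ac_simps flip: fps_const_mult cong: prod.cong sum.cong)
qed

text \<open>The fixed monomial contributes just a constant and a shift by its total degree; all
  growth of the coefficients comes from the K-th power.\<close>

lemma coeff_series_content_product:
  "coeff_series e (content_product (rational_weight K M L) C) =
     (if Poly_Mapping.keys e \<subseteq> weight_vars L (M - K)
      then fps_const ((\<Prod>i=1..L. fps_nth (content_linear C) (lookup e (U i))) *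
             (\<Prod>j=1..M-K. fps_nth (content_geometric C) (lookup e (V j)))) *
           fps_X ^ ((\<Sum>i=1..L. lookup e (U i)) + (\<Sum>j=1..M-K. lookup e (V j))) *
           content_geometric C ^ K
      else 0)"
proof -
  have fin: "finite (weight_vars L (M - K))" by (simp add: weight_vars_def)
  show ?thesis
    unfolding content_product_factors coeff_series_subst_1_mult coeff_series_prod_subst_var[OF fin]
    by (simp add: prod_weight_vars sum_weight_vars mult.commute)
qed

section \<open>Passing to connected numbers\<close>

text \<open>Without constant terms, both indices stay strictly between 0 and n. This is why the
  logarithm brings in smaller sizes only.\<close>

lemma fps_mult_nth_inner:
  fixes F G :: "'a::ring_1 fps"
  assumes "fps_nth F 0 = 0" "fps_nth G 0 = 0"
  shows "fps_nth (F * G) n = (\<Sum>i\<in>{0<..<n}. fps_nth F i * fps_nth G (n - i))"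
  unfolding fps_mult_nth
proof (rule sum.mono_neutral_right)
  show "\<forall>i\<in>{0..n} - {0<..<n}. fps_nth F i * fps_nth G (n - i) = 0"
  proof
    fix i assume "i \<in> {0..n} - {0<..<n}"
    then have "i = 0 \<or> i = n" by auto
    then show "fps_nth F i * fps_nth G (n - i) = 0" using assms by auto
  qed
qed auto

section \<open>Monomials in the p variables\<close>

lemma sum_indicator_nth:
  "(\<Sum>i<length xs. if xs ! i = m then 1 else 0) = (count (mset xs) m :: nat)"
  by (induction xs) (simp_all add: sum.lessThan_Suc_shift del: sum.lessThan_Suc)

lemma lookup_p_exponent:
  "lookup (p_exponent mus) (j, m) = (if j < length mus then count (mset (mus ! j)) m else 0)"
proof -
  have "lookup (p_exponent mus) (j, m) =
      (\<Sum>j'<length mus. if j' = j then \<Sum>i<length (mus ! j). if mus ! j ! i = m then 1 else 0 else 0)"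
    unfolding p_exponent_def lookup_sum
    by (rule sum.cong) (auto simp: lookup_single when_def intro!: sum.cong)
  then show ?thesis by (simp add: sum_indicator_nth)
qed

lemma partitions_eqI:
  assumes "xs \<in> partitions d" "ys \<in> partitions d" "mset xs = mset ys"
  shows "xs = ys"
proof -
  have "sorted (rev xs)" "sorted (rev ys)"
    using assms(1,2) by (auto simp: partitions_def sorted_wrt_rev)
  then have "rev xs = rev ys"
    using properties_for_sort[of "rev xs" "rev ys"] assms(3) by (simp add: sorted_sort_id)
  then show ?thesis by simp
qed

text \<open>The monomial records the multiset of parts at each position, and a decreasing list is
  determined by it. Hence the coefficient of this monomial in \<open>disconn_series\<close> isolates
  one tuple.\<close>

lemma p_exponent_inject:
  assumes "length mus = length mus'" "set mus \<subseteq> partitions d" "set mus' \<subseteq> partitions d"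
    and "p_exponent mus = p_exponent mus'"
  shows "mus = mus'"
proof (rule nth_equalityI)
  fix j assume "j < length mus"
  moreover from this have "mset (mus ! j) = mset (mus' ! j)"
    using lookup_p_exponent[of mus j] lookup_p_exponent[of mus' j] assms(1,4)
    by (intro multiset_eqI) auto
  ultimately show "mus ! j = mus' ! j"
    using assms(1-3) partitions_eqI[of "mus ! j" d "mus' ! j"] by (metis nth_mem subset_iff)
qed (fact assms(1))

lemma partitions_memD:
  assumes "lam \<in> partitions d"
  shows "length lam \<le> d" and "x \<in> set lam \<Longrightarrow> x \<le> d" and "x \<in> set lam \<Longrightarrow> x \<ge> 1"
proof -
  have "length lam \<le> sum_list lam" if "0 \<notin> set lam"
    using that by (induction lam) auto
  then show "length lam \<le> d" using assms by (simp add: partitions_def)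
  show "x \<in> set lam \<Longrightarrow> x \<le> d" using assms member_le_sum_list[of x lam] by (simp add: partitions_def)
  show "x \<in> set lam \<Longrightarrow> x \<ge> 1" using assms by (cases x) (auto simp: partitions_def)
qed

lemma finite_partitions: "finite (partitions d)"
proof (rule finite_subset)
  show "partitions d \<subseteq> {xs. set xs \<subseteq> {..d} \<and> length xs \<le> d}"
    using partitions_memD by (auto simp: subset_iff)
qed (simp add: finite_lists_length_le)

definition contents :: "nat list \<Rightarrow> int multiset" where
  "contents lam = image_mset (\<lambda>(i, j). int j - int i) (mset_set (young_diagram lam))"

lemma prod_young_diagram:
  "(\<Prod>(i, j)\<in>young_diagram lam. G oo (fps_const (of_int (int j - int i)) * fps_X)) =
     content_product G (contents lam)"
  by (simp add: content_product_def contents_def prod_unfold_prod_mset multiset.map_comp comp_def split_beta)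

text \<open>The part of a summand that is independent of r. It is evaluated for the row and the
  column only; elsewhere it is just some constant.\<close>

definition char_weight :: "nat \<Rightarrow> nat list list \<Rightarrow> nat list \<Rightarrow> complex" where
  "char_weight d mus lam = (of_nat (irrep_dim lam) / fact d)\<^sup>2 *
     (\<Prod>i<length mus. irr_char lam (mus ! i) / of_nat (irrep_dim lam))"

definition disconn_coeff :: "uv_poly fps \<Rightarrow> nat \<Rightarrow> nat list list \<Rightarrow> (uv \<Rightarrow>\<^sub>0 nat) \<Rightarrow> complex fps" where
  "disconn_coeff G d mus e =
     (\<Sum>lam\<in>partitions d. fps_const (char_weight d mus lam) * coeff_series e (content_product G (contents lam)))"

lemma coeff_series_hurwitz_disconn:
  "coeff_series e (Abs_fps (\<lambda>r. const_uv c * hurwitz_disconn G d mus r)) =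
     fps_const c * disconn_coeff G d mus e"
proof -
  have "Abs_fps (\<lambda>r. const_uv c * hurwitz_disconn G d mus r) = fps_const (const_uv c) *
      (\<Sum>lam\<in>partitions d. fps_const (const_uv (char_weight d mus lam)) * content_product G (contents lam))"
    unfolding hurwitz_disconn_def prod_young_diagram char_weight_def[symmetric]
    by (simp add: fps_eq_iff)
  then show ?thesis
    by (simp only: coeff_series_scale coeff_series_sum disconn_coeff_def)
qed

lemma class_factor_nonzero:
  assumes "set mus \<subseteq> partitions d"
  shows "class_factor mus \<noteq> 0"
proof -
  have "conj_class (mus ! j) \<noteq> {}" if "j < length mus" for j
    using that assms by (intro conj_class_nonempty[of _ d]) (auto dest: nth_mem)
  then show ?thesis by (auto simp: class_factor_def finite_conj_class)
qed

text \<open>Two instances are needed: convergence beyond the dominant pole, and the degree in a numerator variable.\<close>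

locale graded_class =
  fixes C :: "nat \<Rightarrow> (uv \<Rightarrow>\<^sub>0 nat) \<Rightarrow> complex fps set"
  assumes zero: "0 \<in> C k e"
    and add: "f \<in> C k e \<Longrightarrow> g \<in> C k e \<Longrightarrow> f + g \<in> C k e"
    and scale: "f \<in> C k e \<Longrightarrow> fps_const c * f \<in> C k e"
    and mult: "i > 0 \<Longrightarrow> j > 0 \<Longrightarrow> f \<in> C i e1 \<Longrightarrow> g \<in> C j e2 \<Longrightarrow> f * g \<in> C (i + j) (e1 + e2)"
begin

lemma sum: "(\<And>x. x \<in> A \<Longrightarrow> f x \<in> C k e) \<Longrightarrow> sum f A \<in> C k e"
  by (induction A rule: infinite_finite_induct) (auto intro: zero add)

text \<open>Here k is the degree in \<open>y\<close>. All p-monomials m and all monomials e are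
  quantified, because a product distributes both over its factors.\<close>

definition lifted :: "nat \<Rightarrow> p_poly set" where
  "lifted k = {p. \<forall>m e. coeff_series e (lookup p m) \<in> C k e}"

lemma lifted_sum: "(\<And>x. x \<in> A \<Longrightarrow> f x \<in> lifted k) \<Longrightarrow> sum f A \<in> lifted k"
  by (simp add: lifted_def lookup_sum coeff_series_sum sum)

lemma lifted_mult:
  assumes "i > 0" "j > 0" "p \<in> lifted i" "q \<in> lifted j"
  shows "p * q \<in> lifted (i + j)"
proof -
  have "coeff_series e (lookup (p * q) m) \<in> C (i + j) e" for m e
    unfolding lookup_mult_splits coeff_series_sum
  proof (rule sum, clarify)
    fix m1 m2
    have "coeff_series e1 (lookup p m1) * coeff_series e2 (lookup q m2) \<in> C (i + j) e"
      if "(e1, e2) \<in> splits e" for e1 e2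
      using that mult[OF assms(1,2), of _ e1 _ e2] assms(3,4) by (auto simp: splits_def lifted_def)
    then show "coeff_series e (lookup p m1 * lookup q m2) \<in> C (i + j) e"
      unfolding coeff_series_mult by (intro sum) auto
  qed
  then show ?thesis by (simp add: lifted_def)
qed

lemma lifted_scale:
  "p \<in> lifted k \<Longrightarrow> Poly_Mapping.single 0 (fps_const (const_uv c)) * p \<in> lifted k"
  by (simp add: lifted_def lookup_single_mult coeff_series_scale scale)

text \<open>Only coefficients below n are assumed to lie in the class: at n = d itself the row and
  the column may violate it.\<close>

lemma lifted_fps_mult:
  assumes "fps_nth F 0 = 0" "fps_nth G 0 = 0"
    and "\<And>k. 0 < k \<Longrightarrow> k < n \<Longrightarrow> fps_nth F k \<in> lifted k"
    and "\<And>k. 0 < k \<Longrightarrow> k < n \<Longrightarrow> fps_nth G k \<in> lifted k"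
  shows "fps_nth (F * G) n \<in> lifted n"
  unfolding fps_mult_nth_inner[OF assms(1,2)]
proof (rule lifted_sum)
  fix i assume "i \<in> {0<..<n}"
  then show "fps_nth F i * fps_nth G (n - i) \<in> lifted n"
    using lifted_mult[of i "n - i"] assms(3)[of i] assms(4)[of "n - i"] by auto
qed

lemma lifted_fps_power:
  assumes "fps_nth F 0 = 0" "\<And>k. 0 < k \<Longrightarrow> k < n \<Longrightarrow> fps_nth F k \<in> lifted k"
  shows "0 < k \<Longrightarrow> k < n \<Longrightarrow> fps_nth (F ^ Suc i) k \<in> lifted k"
proof (induction i arbitrary: k)
  case (Suc i)
  have "fps_nth (F ^ Suc i) 0 = 0" using assms(1) by (simp add: fps_mult_nth_0)
  then show ?case
    unfolding power_Suc[of F "Suc i"] using Suc assms by (intro lifted_fps_mult) auto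
qed (use assms in auto)

text \<open>In log(1 + F) the linear term reproduces F, and every higher power reaches degree d
  through coefficients of smaller degree.\<close>

lemma log_one_plus_nth:
  assumes F: "fps_nth F 0 = 0" "\<And>k. 0 < k \<Longrightarrow> k < d \<Longrightarrow> fps_nth F k \<in> lifted k" and d: "d > 0"
  obtains R where "R \<in> lifted d" "fps_nth (log_one_plus F) d = fps_nth F d + R"
proof
  let ?l = "\<lambda>i. Poly_Mapping.single 0 (fps_const (const_uv (fps_nth (fps_ln 1) i))) :: p_poly"
  let ?R = "\<Sum>i\<in>{2..d}. ?l i * fps_nth (F ^ i) d"
  show "?R \<in> lifted d"
  proof (rule lifted_sum)
    fix i assume "i \<in> {2..d}"
    then obtain j where i: "i = Suc (Suc j)" by (metis One_nat_def Suc_1 Suc_le_D atLeastAtMost_iff le_SucE nat.inject not0_implies_Suc not_less_eq_eq)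
    have "fps_nth (F ^ Suc j) 0 = 0" using F(1) by (simp add: fps_mult_nth_0)
    then have "fps_nth (F ^ i) d \<in> lifted d"
      unfolding i power_Suc[of F "Suc j"] using F by (intro lifted_fps_mult lifted_fps_power) auto
    then show "?l i * fps_nth (F ^ i) d \<in> lifted d" by (rule lifted_scale)
  qed
  have "fps_nth (log_one_plus F) d = (\<Sum>i\<in>{0..d}. ?l i * fps_nth (F ^ i) d)"
    by (simp add: log_one_plus_def fps_compose_nth)
  \<comment> \<open>The coefficients of \<open>fps_ln 1\<close> at 0 and 1 are 0 and 1, so the first
    two terms contribute exactly F.\<close>
  also have "{0..d} = insert 0 (insert 1 {2..d})" using d by auto
  also have "(\<Sum>i\<in>\<dots>. ?l i * fps_nth (F ^ i) d) = fps_nth F d + ?R"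
    by (simp add: fps_ln_nth)
  finally show "fps_nth (log_one_plus F) d = fps_nth F d + ?R" .
qed

text \<open>Connected minus disconnected numbers form one series, the same for all r, which inherits
  any property shared by the smaller shapes and stable under the operations of the class.\<close>

lemma hurwitz_conn_coeff:
  assumes d: "d > 0" and mus: "set mus \<subseteq> partitions d"
    and C: "\<And>k lam e. 0 < k \<Longrightarrow> k < d \<Longrightarrow> lam \<in> partitions k \<Longrightarrow>
              coeff_series e (content_product G (contents lam)) \<in> C k e"
  obtains R where "R \<in> C d e"
    "\<And>r. lookup (hurwitz_conn G d mus r) e = fps_nth (disconn_coeff G d mus e + R) r"
proof -
  let ?N = "length mus"
  let ?F = "disconn_series G ?N"
  let ?h = "\<lambda>k mus. Abs_fps (\<lambda>r. const_uv (class_factor mus) * hurwitz_disconn G k mus r)"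
  have F_nth: "lookup (fps_nth ?F k) m =
      (\<Sum>mus' | length mus' = ?N \<and> set mus' \<subseteq> partitions k. if p_exponent mus' = m then ?h k mus' else 0)"
    if "k > 0" for k m
    using that by (simp add: disconn_series_def lookup_sum lookup_single when_def)
  have "fps_nth ?F k \<in> lifted k" if "0 < k" "k < d" for k
  proof -
    have "coeff_series e (?h k mus') \<in> C k e" for mus' e
      unfolding coeff_series_hurwitz_disconn disconn_coeff_def by (intro scale sum C that)
    then show ?thesis unfolding lifted_def mem_Collect_eq F_nth[OF that(1)] coeff_series_sum
      by (auto intro!: sum zero)
  qed
  moreover have "fps_nth ?F 0 = 0" by (simp add: disconn_series_def)
  ultimately obtain R where R: "R \<in> lifted d" "fps_nth (log_one_plus ?F) d = fps_nth ?F d + R"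
    using log_one_plus_nth d by blast
  \<comment> \<open>The connected number divides out the class sizes, so the remainder of the
    logarithm is rescaled likewise.\<close>
  define R' where "R' = fps_const (1 / class_factor mus) * coeff_series e (lookup R (p_exponent mus))"
  have "lookup (fps_nth ?F d) (p_exponent mus) =
      (\<Sum>mus' | length mus' = ?N \<and> set mus' \<subseteq> partitions d. if mus' = mus then ?h d mus' else 0)"
    unfolding F_nth[OF d] by (rule sum.cong) (use p_exponent_inject mus in auto)
  also have "\<dots> = ?h d mus"
    using finite_lists_length_eq[OF finite_partitions, of d ?N] mus by (simp add: sum.delta conj_commute)
  finally have main: "lookup (fps_nth ?F d) (p_exponent mus) = ?h d mus" .
  show ?thesis
  proof
    show "R' \<in> C d e" using R(1) by (simp add: R'_def lifted_def scale)
    fix r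
    have "lookup (hurwitz_conn G d mus r) e =
        fps_nth (fps_const (1 / class_factor mus) * coeff_series e (?h d mus + lookup R (p_exponent mus))) r"
      by (simp add: hurwitz_conn_def R(2) lookup_add main lookup_const_uv_mult coeff_series_def)
    then show "lookup (hurwitz_conn G d mus r) e = fps_nth (disconn_coeff G d mus e + R') r"
      unfolding coeff_series_add coeff_series_hurwitz_disconn R'_def
      using class_factor_nonzero[OF mus] by (simp add: distrib_left)
  qed
qed

end

section \<open>Coefficient asymptotics\<close>

definition abs_conv :: "real \<Rightarrow> complex fps \<Rightarrow> bool" where
  "abs_conv t f \<longleftrightarrow> summable (\<lambda>n. norm (fps_nth f n) * t ^ n)"

lemma abs_conv_0: "abs_conv t 0"
  by (simp add: abs_conv_def)

lemma abs_conv_add: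
  assumes "t > 0" "abs_conv t f" "abs_conv t g" shows "abs_conv t (f + g)"
  unfolding abs_conv_def
proof (rule summable_comparison_test')
  show "summable (\<lambda>n. norm (fps_nth f n) * t ^ n + norm (fps_nth g n) * t ^ n)"
    using assms by (intro summable_add) (simp_all add: abs_conv_def)
  fix n
  have "norm (fps_nth f n + fps_nth g n) * t ^ n \<le> (norm (fps_nth f n) + norm (fps_nth g n)) * t ^ n"
    using assms(1) by (intro mult_right_mono norm_triangle_ineq) simp
  then show "norm (norm (fps_nth (f + g) n) * t ^ n) \<le> norm (fps_nth f n) * t ^ n + norm (fps_nth g n) * t ^ n"
    using assms(1) by (simp add: distrib_right)
qed

lemma abs_conv_mult:
  assumes t: "t > 0" and "abs_conv t f" "abs_conv t g" shows "abs_conv t (f * g)"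
  unfolding abs_conv_def
proof (rule summable_comparison_test')
  show "summable (\<lambda>n. \<Sum>i\<le>n. (norm (fps_nth f i) * t ^ i) * (norm (fps_nth g (n - i)) * t ^ (n - i)))"
    using assms by (intro summable_Cauchy_product) (simp_all add: abs_conv_def)
  fix n
  have "norm (fps_nth (f * g) n) * t ^ n \<le> (\<Sum>i=0..n. norm (fps_nth f i) * norm (fps_nth g (n - i))) * t ^ n"
    using t unfolding fps_mult_nth
    by (intro mult_right_mono order.trans[OF norm_sum] sum_mono) (simp_all add: norm_mult)
  also have "\<dots> = (\<Sum>i\<le>n. (norm (fps_nth f i) * t ^ i) * (norm (fps_nth g (n - i)) * t ^ (n - i)))"
    unfolding sum_distrib_right atLeast0AtMost
  proof (rule sum.cong[OF refl])
    fix i assume "i \<in> {..n}"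
    then have "t ^ n = t ^ i * t ^ (n - i)" by (simp flip: power_add)
    then show "norm (fps_nth f i) * norm (fps_nth g (n - i)) * t ^ n =
        (norm (fps_nth f i) * t ^ i) * (norm (fps_nth g (n - i)) * t ^ (n - i))" by simp
  qed
  finally show "norm (norm (fps_nth (f * g) n) * t ^ n) \<le>
      (\<Sum>i\<le>n. (norm (fps_nth f i) * t ^ i) * (norm (fps_nth g (n - i)) * t ^ (n - i)))"
    using t by simp
qed

lemma abs_conv_finite_support:
  assumes "\<And>n. n > m \<Longrightarrow> fps_nth f n = 0" shows "abs_conv t f"
  unfolding abs_conv_def by (rule summable_finite[of "{..m}"]) (auto simp: assms)

lemma abs_conv_const: "abs_conv t (fps_const c)"
  and abs_conv_X_power: "abs_conv t (fps_X ^ k)"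
  by (rule abs_conv_finite_support[of k]; simp)+

lemma abs_conv_power: "t > 0 \<Longrightarrow> abs_conv t f \<Longrightarrow> abs_conv t (f ^ n)"
  using abs_conv_const[of t 1] by (induction n) (auto intro: abs_conv_mult)

lemma abs_conv_geometric:
  assumes "norm c * t < 1" "t > 0" shows "abs_conv t (geometric_series c)"
proof -
  have "norm (norm c * t) < 1" using assms by simp
  then have "summable (\<lambda>n. (norm c * t) ^ n)" by (rule summable_geometric)
  then show ?thesis by (simp add: abs_conv_def geometric_series_def norm_power power_mult_distrib)
qed

lemma abs_conv_content_geometric:
  assumes t: "t > 0" and C: "\<And>c. c \<in># C \<Longrightarrow> \<bar>real_of_int c\<bar> * t < 1"
  shows "abs_conv t (content_geometric C)"
  using C
proof (induction C)
  case empty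
  show ?case using abs_conv_const[of t 1] by (simp add: content_geometric_def)
next
  case (add c C)
  have "abs_conv t (geometric_series (of_int c))" using add.prems[of c] t by (intro abs_conv_geometric) auto
  moreover have "abs_conv t (content_geometric C)" using add by auto
  ultimately show ?case using abs_conv_mult[OF t] by (simp add: content_geometric_def)
qed

lemma abs_conv_content_product:
  assumes "t > 0" "\<And>c. c \<in># C \<Longrightarrow> \<bar>real_of_int c\<bar> * t < 1"
  shows "abs_conv t (coeff_series e (content_product (rational_weight K M L) C))"
  unfolding coeff_series_content_product
  using assms by (auto intro!: abs_conv_mult abs_conv_power abs_conv_content_geometric
      abs_conv_const abs_conv_X_power abs_conv_0)

lemma abs_conv_tendsto_0:
  assumes "abs_conv t f" "t > 0"
  shows "(\<lambda>n. fps_nth f n * of_real t ^ n) \<longlonglongrightarrow> 0"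
proof (rule tendsto_norm_zero_cancel)
  show "(\<lambda>n. norm (fps_nth f n * of_real t ^ n)) \<longlonglongrightarrow> 0"
    using summable_LIMSEQ_zero[of "\<lambda>n. norm (fps_nth f n) * t ^ n"] assms
    by (simp add: abs_conv_def norm_mult norm_power)
qed

text \<open>Normalizing by n + 1 instead of n keeps the denominator nonzero at n = 0 and matches the
  rising factorial that starts at n + 1.\<close>

definition coeff_asymp :: "nat \<Rightarrow> real \<Rightarrow> complex fps \<Rightarrow> complex \<Rightarrow> bool" where
  "coeff_asymp m rho f l \<longleftrightarrow> (\<lambda>n. fps_nth f n / (of_nat (Suc n) ^ m * of_real rho ^ n)) \<longlonglongrightarrow> l"

text \<open>A factor analytic beyond 1 / rho multiplies the limit by its value at 1 / rho. The
  normalized convolution is a sum over k whose terms tend to l q^k and are dominated by B |q|^k, so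
  Tannery's theorem applies.\<close>

lemma coeff_asymp_mult_geometric:
  assumes f: "coeff_asymp m rho f l" and rho: "rho > 0" and c: "norm c < rho"
  shows "coeff_asymp m rho (f * geometric_series c) (l / (1 - c / of_real rho))"
proof -
  define al where "al = (\<lambda>n. of_nat (Suc n) ^ m * of_real rho ^ n :: complex)"
  define h where "h = (\<lambda>n. fps_nth f n / al n)"
  define q where "q = c / of_real rho"
  have al: "al n \<noteq> 0" for n using rho by (simp add: al_def del: of_nat_Suc)
  have h: "h \<longlonglongrightarrow> l" using f by (simp add: coeff_asymp_def h_def al_def)
  then obtain B where B: "\<And>n. norm (h n) \<le> B"
    using convergent_imp_Bseq[of h] by (auto simp: convergent_def Bseq_def)
  have q: "norm q < 1" using c rho by (simp add: q_def norm_divide)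
  \<comment> \<open>Ratio of the polynomial normalizations: at most 1 in norm, and tending to 1 for
    fixed k. Extending \<open>s\<close> by 0 for k > n makes the convolution an infinite
    sum.\<close>
  define w where "w = (\<lambda>k n. (of_nat (Suc (n - k)) / of_nat (Suc n)) ^ m :: complex)"
  define s where "s = (\<lambda>k n. if k \<le> n then h (n - k) * w k n * q ^ k else 0)"
  have s_eq: "s k n = fps_nth f (n - k) * c ^ k / al n" if "k \<le> n" for k n
  proof -
    have "al n = of_nat (Suc n) ^ m * of_real rho ^ (n - k) * of_real rho ^ k"
      using that by (simp add: al_def mult.assoc flip: power_add)
    moreover have "al (n - k) = of_nat (Suc (n - k)) ^ m * of_real rho ^ (n - k)" by (simp add: al_def)
    ultimately show ?thesis using that rho
      by (simp add: s_def h_def w_def q_def power_divide del: of_nat_Suc)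
  qed
  have sum_s: "suminf (\<lambda>k. s k n) = fps_nth (f * geometric_series c) n / al n" for n
  proof -
    have "suminf (\<lambda>k. s k n) = (\<Sum>k\<in>{0..n}. s k n)"
      by (rule suminf_finite) (auto simp: s_def)
    also have "\<dots> = (\<Sum>k\<in>{0..n}. fps_nth f (n - k) * c ^ k / al n)"
      by (rule sum.cong) (auto simp: s_eq)
    also have "\<dots> = fps_nth (geometric_series c * f) n / al n"
      unfolding fps_mult_nth sum_divide_distrib by (simp add: geometric_series_def mult.commute)
    finally show ?thesis by (simp add: mult.commute)
  qed
  have "(\<lambda>n. suminf (\<lambda>k. s k n)) \<longlonglongrightarrow> suminf (\<lambda>k. l * q ^ k)"
  proof (rule tannerys_theorem[THEN conjunct2, THEN conjunct2])
    show "((\<lambda>n. s k n) \<longlongrightarrow> l * q ^ k) sequentially" for k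
    \<comment> \<open>After shifting by k the case k > n disappears.\<close>
    proof (rule LIMSEQ_offset[of _ k])
      have "(\<lambda>n. of_nat (Suc n) / of_nat (Suc (n + k)) :: complex) \<longlonglongrightarrow> 1"
      proof -
        have "(\<lambda>n. 1 - of_nat k * (1 / of_nat (Suc (n + k))) :: complex) \<longlonglongrightarrow> 1 - of_nat k * 0"
          by (intro tendsto_intros LIMSEQ_ignore_initial_segment[of "\<lambda>n. 1 / of_nat (Suc n)"] lim_1_over_n[THEN LIMSEQ_Suc])
        moreover have "1 - of_nat k * (1 / of_nat (Suc (n + k))) = (of_nat (Suc n) / of_nat (Suc (n + k)) :: complex)" for n
          by (simp add: divide_simps del: of_nat_Suc) (simp add: algebra_simps)
        ultimately show ?thesis by simp
      qed
      then have "(\<lambda>n. h n * (of_nat (Suc n) / of_nat (Suc (n + k))) ^ m * q ^ k) \<longlonglongrightarrow> l * 1 ^ m * q ^ k"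
        by (intro tendsto_intros h)
      then show "(\<lambda>n. s k (n + k)) \<longlonglongrightarrow> l * q ^ k"
        by (simp add: s_def w_def del: of_nat_Suc)
    qed
    have "norm (s k n) \<le> B * norm q ^ k" for k n
    proof (cases "k \<le> n")
      case True
      have "norm (w k n) = (real (Suc (n - k)) / real (Suc n)) ^ m"
        by (simp add: w_def norm_power norm_divide del: of_nat_Suc)
      also have "\<dots> \<le> 1" by (rule power_le_one) (auto simp del: of_nat_Suc)
      finally have "norm (h (n - k)) * norm (w k n) * norm q ^ k \<le> B * 1 * norm q ^ k"
        using B[of "n - k"] order.trans[OF norm_ge_zero B[of 0]]
        by (intro mult_right_mono mult_mono) auto
      then show ?thesis using True by (simp add: s_def norm_mult norm_power)
    qed (use order.trans[OF norm_ge_zero B[of 0]] in \<open>simp add: s_def\<close>)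
    then show "eventually (\<lambda>(k, n). norm (s k n) \<le> B * norm q ^ k) (at_top \<times>\<^sub>F sequentially)"
      by (intro always_eventually) auto
    show "summable (\<lambda>k. B * norm q ^ k)"
      using q by (intro summable_mult summable_geometric) simp
  qed simp
  moreover have "suminf (\<lambda>k. l * q ^ k) = l / (1 - q)"
    using suminf_mult[OF summable_geometric[OF q], of l] suminf_geometric[OF q] by simp
  ultimately show ?thesis
    by (simp add: coeff_asymp_def sum_s al_def q_def)
qed

lemma coeff_asymp_mult_prod:
  assumes "finite A" "coeff_asymp m rho f l" "rho > 0" "\<And>x. x \<in> A \<Longrightarrow> norm (c x) < rho"
  shows "coeff_asymp m rho (f * (\<Prod>x\<in>A. geometric_series (c x))) (l / (\<Prod>x\<in>A. 1 - c x / of_real rho))"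
  using assms
proof (induction A rule: finite_induct)
  case (insert x A)
  then have "coeff_asymp m rho (f * (\<Prod>x\<in>A. geometric_series (c x)) * geometric_series (c x))
      (l / (\<Prod>x\<in>A. 1 - c x / of_real rho) / (1 - c x / of_real rho))"
    by (intro coeff_asymp_mult_geometric) auto
  then show ?case using insert.hyps by (simp add: ac_simps)
qed simp

lemma coeff_asymp_mult_prod_power:
  assumes "finite A" "coeff_asymp m rho f l" "rho > 0" "\<And>x. x \<in> A \<Longrightarrow> norm (c x) < rho"
  shows "coeff_asymp m rho (f * (\<Prod>x\<in>A. geometric_series (c x)) ^ k) (l / (\<Prod>x\<in>A. 1 - c x / of_real rho) ^ k)"
proof (induction k)
  case (Suc k)
  show ?case using coeff_asymp_mult_prod[OF assms(1) Suc.IH assms(3,4)] by (simp add: ac_simps)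
qed (simp add: assms)

text \<open>Negative binomial series; the induction step is the hockey-stick identity.\<close>

lemma geometric_power_nth: "fps_nth (geometric_series c ^ Suc m) n = of_nat (n + m choose m) * c ^ n"
proof (induction m arbitrary: n)
  case 0
  show ?case by (simp add: geometric_series_def)
next
  case (Suc m)
  have "fps_nth (geometric_series c ^ Suc (Suc m)) n = (\<Sum>i=0..n. of_nat (i + m choose m) * c ^ i * c ^ (n - i))"
    unfolding power_Suc2[of _ "Suc m"] fps_mult_nth Suc.IH by (simp add: geometric_series_def)
  also have "\<dots> = (\<Sum>i=0..n. of_nat (i + m choose m) * c ^ n)"
    by (rule sum.cong) (auto simp: mult.assoc simp flip: power_add)
  also have "\<dots> = of_nat (\<Sum>i\<le>n. (m + i choose m)) * c ^ n"
    by (simp add: sum_distrib_right atLeast0AtMost add.commute)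
  also have "(\<Sum>i\<le>n. (m + i choose m)) = (n + Suc m choose Suc m)"
    using choose_rising_sum(1)[of m n] by (simp add: add.commute)
  finally show ?case .
qed

text \<open>The binomial is the rising factorial of n + 1 of length m over m!, so the normalization
  leaves m factors 1 + i / (n + 1), each tending to 1.\<close>

lemma coeff_asymp_geometric_power:
  assumes "rho > 0"
  shows "coeff_asymp m rho (geometric_series (of_real rho) ^ Suc m) (1 / fact m)"
proof -
  have "fps_nth (geometric_series (of_real rho) ^ Suc m) n / (of_nat (Suc n) ^ m * of_real rho ^ n) =
      (\<Prod>i<m. 1 + of_nat i * (1 / of_nat (Suc n))) / fact m" for n
  proof -
    have "of_nat (n + m choose m) = (\<Prod>i<m. of_nat (Suc n) + of_nat i :: complex) / fact m"
      by (simp add: binomial_gbinomial gbinomial_pochhammer' pochhammer_prod atLeast0LessThan add.commute add.left_commute)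
    also have "(\<Prod>i<m. of_nat (Suc n) + of_nat i :: complex) =
        (\<Prod>i<m. of_nat (Suc n) * (1 + of_nat i * (1 / of_nat (Suc n))))"
      by (rule prod.cong) (simp_all add: distrib_left del: of_nat_Suc)
    also have "\<dots> = of_nat (Suc n) ^ m * (\<Prod>i<m. 1 + of_nat i * (1 / of_nat (Suc n)))"
      by (simp only: prod.distrib prod_constant card_lessThan)
    finally show ?thesis using assms
      unfolding geometric_power_nth by (simp del: of_nat_Suc)
  qed
  moreover have "(\<lambda>n. (\<Prod>i<m. 1 + of_nat i * (1 / of_nat (Suc n))) / fact m :: complex) \<longlonglongrightarrow> (\<Prod>i<m. 1 + of_nat i * 0) / fact m"
    by (intro tendsto_intros lim_1_over_n[THEN LIMSEQ_Suc]) simp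
  ultimately show ?thesis by (simp add: coeff_asymp_def)
qed

text \<open>For n = d - 1 the reciprocal is the constant (d - 1)^(d - 2) / (d - 2)! of the final
  formula.\<close>

lemma prod_one_minus_ratio:
  assumes "n > 0"
  shows "(\<Prod>c<n. 1 - of_nat c / of_nat n) = (fact (n - 1) / of_nat n ^ (n - 1) :: complex)"
proof -
  have "(\<Prod>c<n. 1 - of_nat c / of_nat n) = (\<Prod>c<n. of_nat (n - c) / of_nat n :: complex)"
    by (rule prod.cong) (use assms in \<open>auto simp: of_nat_diff divide_simps\<close>)
  also have "\<dots> = of_nat (\<Prod>c<n. n - c) / of_nat n ^ n"
    by (simp add: prod_dividef)
  also have "(\<Prod>c<n. n - c) = fact n"
    by (simp add: fact_prod_rev atLeast0LessThan)
  finally have eq: "(\<Prod>c<n. 1 - of_nat c / of_nat n) = (fact n / of_nat n ^ n :: complex)" by simp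
  have "(fact n :: complex) = of_nat n * fact (n - 1)" by (rule fact_reduce[OF assms])
  moreover have "(of_nat n :: complex) ^ n = of_nat n * of_nat n ^ (n - 1)"
    by (metis Suc_diff_1 assms power_Suc)
  ultimately show ?thesis using assms eq by simp
qed

text \<open>Here n = d - 1. Content n yields a pole of order K at 1 / n, hence growth of degree K -
  1; the smaller contents are evaluated at that pole.\<close>

lemma coeff_asymp_row:
  assumes K: "K \<ge> 1" and n: "n > 0"
  shows "coeff_asymp (K - 1) (real n) ((\<Prod>c<Suc n. geometric_series (of_nat c)) ^ K)
    ((of_nat n ^ (n - 1) / fact (n - 1)) ^ K / fact (K - 1))"
proof -
  have "coeff_asymp (K - 1) (real n) (geometric_series (of_nat n) ^ K * (\<Prod>c<n. geometric_series (of_nat c)) ^ K)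
      (1 / fact (K - 1) / (\<Prod>c<n. 1 - of_nat c / of_real (real n)) ^ K)"
    using coeff_asymp_geometric_power[of "real n" "K - 1"] K n
    by (intro coeff_asymp_mult_prod_power) auto
  then show ?thesis using prod_one_minus_ratio[OF n]
    by (simp add: power_mult_distrib power_divide mult.commute)
qed

section \<open>Contents of Young diagrams\<close>

lemma young_diagram_Sigma:
  "young_diagram lam = (SIGMA i:{1..length lam}. {1..lam ! (i - 1)})"
  by (auto simp: young_diagram_def)

lemma finite_young_diagram: "finite (young_diagram lam)"
  by (simp add: young_diagram_Sigma)

lemma card_young_diagram: "card (young_diagram lam) = sum_list lam"
proof -
  have "card (young_diagram lam) = (\<Sum>i\<in>{1..length lam}. lam ! (i - 1))"
    by (simp add: young_diagram_Sigma)
  also have "\<dots> = (\<Sum>i<length lam. lam ! i)"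
    by (rule sum.reindex_bij_witness[of _ Suc "\<lambda>i. i - 1"]) auto
  finally show ?thesis by (simp add: sum_list_sum_nth atLeast0LessThan)
qed

lemma size_contents: "size (contents lam) = sum_list lam"
  by (simp add: contents_def card_young_diagram)

lemma length_le_sum_list: "0 \<notin> set xs \<Longrightarrow> length xs \<le> sum_list (xs :: nat list)"
  by (induction xs) auto

lemma sum_list_eq_length: "0 \<notin> set xs \<Longrightarrow> sum_list xs = length xs \<Longrightarrow> xs = replicate (length xs) (1 :: nat)"
proof (induction xs)
  case (Cons x xs)
  have "length xs \<le> sum_list xs" "x \<noteq> 0" using Cons.prems length_le_sum_list[of xs] by auto
  then have "x = 1" "sum_list xs = length xs" using Cons.prems by auto
  then show ?case using Cons by auto
qed simp

lemma partitions_large_part: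
  assumes "lam \<in> partitions d" "d \<in> set lam" shows "lam = [d]"
proof -
  obtain xs ys where lam: "lam = xs @ d # ys" using assms(2) by (meson split_list)
  have "sum_list xs + sum_list ys = 0" "0 \<notin> set xs" "0 \<notin> set ys"
    using assms(1) by (auto simp: partitions_def lam)
  then have "xs = []" "ys = []" by (cases xs, auto) (cases ys, auto)
  then show ?thesis using lam by simp
qed

lemma partitions_length_eq:
  assumes "lam \<in> partitions d" "length lam = d" shows "lam = replicate d 1"
  using assms sum_list_eq_length[of lam] by (auto simp: partitions_def)

text \<open>A content j - i is bounded above by a part minus 1 and below by 1 minus the number of
  parts. Only the row has a part d, and only the column has d parts.\<close>

lemma contents_bound:
  assumes lam: "lam \<in> partitions d" and c: "c \<in># contents lam"
  shows "\<bar>c\<bar> \<le> int d - 1"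
    and "lam \<noteq> [d] \<Longrightarrow> lam \<noteq> replicate d 1 \<Longrightarrow> \<bar>c\<bar> \<le> int d - 2"
proof -
  obtain i j where ij: "(i, j) \<in> young_diagram lam" "c = int j - int i"
    using c finite_young_diagram[of lam] by (auto simp: contents_def)
  have i: "1 \<le> i" "i \<le> length lam" and j: "1 \<le> j" "j \<le> lam ! (i - 1)"
    using ij(1) by (auto simp: young_diagram_def)
  have mem: "lam ! (i - 1) \<in> set lam" using i by simp
  show "\<bar>c\<bar> \<le> int d - 1"
    using i j ij(2) partitions_memD(1)[OF lam] partitions_memD(2)[OF lam mem] by linarith
  assume "lam \<noteq> [d]" "lam \<noteq> replicate d 1"
  then have "length lam \<noteq> d" "lam ! (i - 1) \<noteq> d"
    using partitions_length_eq[OF lam] partitions_large_part[OF lam] mem by auto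
  then show "\<bar>c\<bar> \<le> int d - 2"
    using i j ij(2) partitions_memD(1)[OF lam] partitions_memD(2)[OF lam mem] by linarith
qed

lemma zero_in_contents:
  assumes "lam \<in> partitions d" "d > 0" shows "0 \<in># contents lam"
proof -
  have "lam \<noteq> []" using assms by (auto simp: partitions_def)
  then have "lam ! 0 \<ge> 1" using partitions_memD(3)[OF assms(1)] by simp
  then have "(1, 1) \<in> young_diagram lam" using \<open>lam \<noteq> []\<close> by (auto simp: young_diagram_def Suc_le_eq)
  then show ?thesis using finite_young_diagram[of lam]
    by (force simp: contents_def)
qed

section \<open>Symmetric functions of contents and Stirling numbers\<close>

lemma fps_mult_linear_nth:
  "fps_nth (f * linear_series c) n = fps_nth f n + (if n = 0 then 0 else c * fps_nth f (n - 1))"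
  by (simp add: linear_series_def distrib_left mult.assoc[symmetric] mult.commute[of f])

lemma content_linear_degree: "n > size C \<Longrightarrow> fps_nth (content_linear C) n = 0"
proof (induction C arbitrary: n)
  case (add c C)
  have "content_linear (add_mset c C) = content_linear C * linear_series (of_int c)"
    by (simp add: content_linear_def mult.commute)
  then show ?case using add by (simp add: fps_mult_linear_nth)
qed (simp add: content_linear_def)

text \<open>The box \<open>(1, 1)\<close> has content 0, so the degree is smaller than the number of boxes.\<close>

lemma content_linear_partition_degree:
  assumes "lam \<in> partitions d" "d > 0" "n \<ge> d"
  shows "fps_nth (content_linear (contents lam)) n = 0"
proof -
  obtain C where C: "contents lam = add_mset 0 C"
    using zero_in_contents[OF assms(1,2)] by (metis insert_DiffM)
  then have "content_linear (contents lam) = content_linear C"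
    by (simp add: content_linear_def linear_series_def)
  moreover have "size C < n"
    using size_contents[of lam] C assms by (simp add: partitions_def)
  ultimately show ?thesis by (simp add: content_linear_degree)
qed

lemma contents_row: "contents [d] = image_mset int (mset_set {..<d})"
proof -
  have "young_diagram [d] = {1} \<times> {1..d}" by (auto simp: young_diagram_def)
  then have "young_diagram [d] = (\<lambda>j. (1, Suc j)) ` {..<d}"
    unfolding image_Suc_lessThan[symmetric] by auto
  moreover have "inj_on (\<lambda>j. (1 :: nat, Suc j)) {..<d}" by (simp add: inj_on_def)
  ultimately show ?thesis
    by (simp add: contents_def image_mset_mset_set[symmetric] multiset.map_comp comp_def)
qed

lemma contents_column: "contents (replicate d 1) = image_mset uminus (contents [d])"
proof -
  have "young_diagram (replicate d 1) = {1..d} \<times> {1}" by (auto simp: young_diagram_def)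
  then have "young_diagram (replicate d 1) = (\<lambda>j. (Suc j, 1)) ` {..<d}"
    unfolding image_Suc_lessThan[symmetric] by auto
  moreover have "inj_on (\<lambda>j. (Suc j, 1 :: nat)) {..<d}" by (simp add: inj_on_def)
  ultimately show ?thesis unfolding contents_row
    by (simp add: contents_def image_mset_mset_set[symmetric] multiset.map_comp comp_def)
qed

lemma content_linear_row: "content_linear (contents [d]) = (\<Prod>c<d. linear_series (of_nat c))"
  and content_geometric_row: "content_geometric (contents [d]) = (\<Prod>c<d. geometric_series (of_nat c))"
  by (simp_all add: content_linear_def content_geometric_def contents_row multiset.map_comp comp_def
      prod_unfold_prod_mset)

text \<open>Multiplying by 1 + d z is the recurrence of the first-kind numbers. The truncated d - n
  is harmless: for n at least d it is 0, and \<open>stirling d 0\<close> = 0 agrees with the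
  vanishing coefficient.\<close>

lemma content_linear_row_nth:
  assumes "d > 0"
  shows "fps_nth (content_linear (contents [d])) n = of_nat (stirling d (d - n))"
  using assms
proof (induction d arbitrary: n rule: nat_induct_non_zero)
  case 1
  show ?case by (cases n) (simp_all add: content_linear_row linear_series_def)
next
  case (Suc d)
  have rec: "fps_nth (content_linear (contents [Suc d])) n = of_nat (stirling d (d - n)) +
      (if n = 0 then 0 else of_nat d * of_nat (stirling d (d - (n - 1))))"
    using Suc.IH by (simp add: content_linear_row fps_mult_linear_nth)
  show ?case
  proof (cases "n \<le> d")
    case True
    \<comment> \<open>Writing d as n + k resolves the subtractions in the recurrence.\<close>
    then obtain k where "d = n + k" using le_Suc_ex by blast
    then show ?thesis unfolding rec by (cases n) (simp_all add: algebra_simps)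
  next
    case False
    then show ?thesis unfolding rec using Suc.hyps by (simp add: not_le)
  qed
qed

lemma fps_mult_geometric_rec:
  "fps_nth (f * geometric_series c) n = fps_nth f n + (if n = 0 then 0 else c * fps_nth (f * geometric_series c) (n - 1))"
proof -
  have "f = (f * geometric_series c) * linear_series (- c)"
    using linear_times_geometric[of c] by (simp add: mult.assoc mult.commute[of "geometric_series c"])
  then have "fps_nth f n = fps_nth (f * geometric_series c) n + (if n = 0 then 0 else - c * fps_nth (f * geometric_series c) (n - 1))"
    by (metis fps_mult_linear_nth)
  then show ?thesis by simp
qed

text \<open>Appending a content multiplies by a geometric series, whose recurrence in n is that of
  the second-kind numbers; hence an induction on n inside the one on d.\<close>

lemma content_geometric_row_nth:
  "fps_nth (content_geometric (contents [Suc d])) n = of_nat (Stirling (n + d) d)"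
proof (induction d arbitrary: n)
  case 0
  show ?case by (cases n) (simp_all add: content_geometric_row geometric_series_def)
next
  case (Suc d)
  have eq: "content_geometric (contents [Suc (Suc d)]) = content_geometric (contents [Suc d]) * geometric_series (of_nat (Suc d))"
    by (simp add: content_geometric_row)
  show ?case
  proof (induction n)
    case 0
    show ?case using Suc.IH[of 0] unfolding eq fps_mult_geometric_rec[of _ _ 0] by simp
  next
    case (Suc n)
    show ?case
      using Suc.IH Suc.prems \<open>\<And>n. fps_nth (content_geometric (contents [Suc d])) n = of_nat (Stirling (n + d) d)\<close>
      unfolding eq fps_mult_geometric_rec[of _ _ "Suc n"] by (simp add: algebra_simps)
  qed
qed

text \<open>G(-c z) = G(c (-z)): negating all contents reflects z. Thus the column series has the
  row coefficients up to the sign (-1)^r.\<close>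

lemma content_product_uminus:
  "content_product G (image_mset uminus C) = dilate (-1) (content_product G C)"
proof (induction C)
  case (add c C)
  have "G oo (fps_const (of_int (- c)) * fps_X) = dilate (-1) (G oo (fps_const (of_int c) * fps_X))"
  proof -
    have "(- of_int c :: uv_poly) ^ n = (-1) ^ n * of_int c ^ n" for n
      by (metis mult_minus1 power_mult_distrib)
    then show ?thesis by (simp add: fps_compose_linear dilate_def mult.assoc)
  qed
  then show ?case using add by (simp add: content_product_def dilate_mult)
qed (simp add: content_product_def)

lemma coeff_series_dilate: "coeff_series e (dilate (-1) f) = dilate (-1) (coeff_series e f)"
proof -
  have "(-1 :: uv_poly) ^ n = const_uv ((-1) ^ n)" for n
    by (simp add: const_uv_power const_uv_minus)
  then show ?thesis by (simp add: coeff_series_def dilate_def lookup_const_uv_mult)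
qed

lemma stirling_pos: "1 \<le> k \<Longrightarrow> k \<le> n \<Longrightarrow> stirling n k > 0"
  by (induction n k rule: stirling.induct) (auto simp: le_Suc_eq Suc_le_eq)

lemma Stirling_pos: "1 \<le> k \<Longrightarrow> k \<le> n \<Longrightarrow> Stirling n k > 0"
  by (induction n k rule: Stirling.induct) (auto simp: le_Suc_eq Suc_le_eq)

section \<open>Asymptotics of connected Hurwitz numbers\<close>

lemma graded_class_abs_conv: "t > 0 \<Longrightarrow> graded_class (\<lambda>k e. {f. abs_conv t f})"
  by unfold_locales (auto intro: abs_conv_0 abs_conv_add abs_conv_mult abs_conv_const)

text \<open>Expresses that the degree in \<open>x\<close> is below the size k: if the
  \<open>x\<close>-exponent of a product reaches i + j, then it reaches i in one factor or j in the
  other.\<close>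

lemma graded_class_degree: "graded_class (\<lambda>k e. {f. k \<le> lookup e x \<longrightarrow> f = 0})"
proof
  fix i j :: nat and e1 e2 :: "uv \<Rightarrow>\<^sub>0 nat" and f g :: "complex fps"
  assume "f \<in> {f. i \<le> lookup e1 x \<longrightarrow> f = 0}" "g \<in> {f. j \<le> lookup e2 x \<longrightarrow> f = 0}"
  moreover have "i \<le> lookup e1 x \<or> j \<le> lookup e2 x" if "i + j \<le> lookup (e1 + e2) x"
    using that by (auto simp: lookup_add)
  ultimately show "f * g \<in> {f. i + j \<le> lookup (e1 + e2) x \<longrightarrow> f = 0}" by auto
qed auto

lemma hurwitz_conn_eq_0:
  assumes d: "d > 0" and mus: "set mus \<subseteq> partitions d"
    and i: "i \<in> {1..L}" and e: "lookup e (U i) \<ge> d"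
  shows "lookup (hurwitz_conn (rational_weight K M L) d mus r) e = 0"
proof -
  interpret graded_class "\<lambda>k e. {f. k \<le> lookup e (U i) \<longrightarrow> f = 0}" by (rule graded_class_degree)
  have zero: "coeff_series e (content_product (rational_weight K M L) (contents lam)) = 0"
    if "0 < k" "lam \<in> partitions k" "k \<le> lookup e (U i)" for k lam e
  proof -
    have "(\<Prod>i=1..L. fps_nth (content_linear (contents lam)) (lookup e (U i))) = 0"
      using content_linear_partition_degree[OF that(2,1,3)] i by (auto simp: prod_zero_iff)
    then show ?thesis unfolding coeff_series_content_product by simp
  qed
  obtain R where R: "R \<in> {f. d \<le> lookup e (U i) \<longrightarrow> f = 0}"
    "\<And>r. lookup (hurwitz_conn (rational_weight K M L) d mus r) e =
       fps_nth (disconn_coeff (rational_weight K M L) d mus e + R) r"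
    using hurwitz_conn_coeff[OF d mus, of "rational_weight K M L" e] zero by auto
  have "disconn_coeff (rational_weight K M L) d mus e = 0"
    unfolding disconn_coeff_def using zero[OF d _ e] by simp
  then show ?thesis using R e by simp
qed

lemma row_column_mem_partitions: "d > 0 \<Longrightarrow> [d] \<in> partitions d" "replicate d 1 \<in> partitions d"
  by (auto simp: partitions_def sum_list_replicate sorted_wrt_iff_nth_less)

lemma hurwitz_conn_decomposition:
  fixes K M L d :: nat and e
  defines "W \<equiv> coeff_series e (content_product (rational_weight K M L) (contents [d]))"
  assumes d: "d \<ge> 2" and mus: "set mus \<subseteq> partitions d"
  obtains R where "abs_conv (2 / (2 * real d - 3)) R"
    and "\<And>r. lookup (hurwitz_conn (rational_weight K M L) d mus r) e =
      (1 + (-1) ^ (r + (\<Sum>i<length mus. d - length (mus ! i)))) / (fact d)\<^sup>2 * fps_nth W r + fps_nth R r"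
proof -
  define t where "t = 2 / (2 * real d - 3)"
  have t: "t > 0" using d by (simp add: t_def)
  have small: "\<bar>real_of_int c\<bar> * t < 1" if "\<bar>c\<bar> \<le> int d - 2" for c
  proof -
    have "\<bar>real_of_int c\<bar> \<le> real d - 2" using that by linarith
    moreover have "2 * real d - 3 > 0" using d by simp
    ultimately show ?thesis by (simp add: t_def field_simps)
  qed
  interpret graded_class "\<lambda>k e. {f. abs_conv t f}" by (rule graded_class_abs_conv[OF t])
  let ?G = "rational_weight K M L"
  let ?P = "\<lambda>lam. coeff_series e (content_product ?G (contents lam))"
  have lower: "coeff_series e (content_product ?G (contents lam)) \<in> {f. abs_conv t f}"
    if "0 < k" "k < d" "lam \<in> partitions k" for k lam e
    unfolding mem_Collect_eq
  proof (rule abs_conv_content_product[OF t])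
    fix c assume "c \<in># contents lam"
    then have "\<bar>c\<bar> \<le> int k - 1" using that(3) by (rule contents_bound(1)[rotated])
    \<comment> \<open>From k < d one has k - 1 at most d - 2, so even the row and column of a
      smaller size converge.\<close>
    then show "\<bar>real_of_int c\<bar> * t < 1" using that(2) by (intro small) simp
  qed
  have "d > 0" using d by simp
  obtain R1 where "R1 \<in> {f. abs_conv t f}" and R1_nth:
    "\<And>r. lookup (hurwitz_conn ?G d mus r) e = fps_nth (disconn_coeff ?G d mus e + R1) r"
  proof (rule hurwitz_conn_coeff[OF \<open>d > 0\<close> mus lower, where e = e])
    fix R assume "R \<in> {f. abs_conv t f}"
      "\<And>r. lookup (hurwitz_conn ?G d mus r) e = fps_nth (disconn_coeff ?G d mus e + R) r"
    then show thesis by (rule that)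
  qed
  then have R1: "abs_conv t R1" by simp
  define R2 where "R2 = (\<Sum>lam\<in>partitions d - {[d], replicate d 1}. fps_const (char_weight d mus lam) * ?P lam)"
  have "abs_conv t (?P lam)" if "lam \<in> partitions d - {[d], replicate d 1}" for lam
    by (rule abs_conv_content_product[OF t], rule small, rule contents_bound(2)) (use that in auto)
  then have "R2 \<in> {f. abs_conv t f}" unfolding R2_def by (intro sum scale) simp
  then have R2: "abs_conv t R2" by simp
  \<comment> \<open>For d = 1 row and column coincide and would be counted twice.\<close>
  have ne: "[d] \<noteq> replicate d 1"
    using d by (metis One_nat_def length_Cons length_replicate list.size(3) not_less_eq_eq numeral_2_eq_2 order_refl)
  have "partitions d = insert [d] (insert (replicate d 1) (partitions d - {[d], replicate d 1}))"
    using row_column_mem_partitions[of d] d by auto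
  then have "disconn_coeff ?G d mus e =
      (\<Sum>lam\<in>insert [d] (insert (replicate d 1) (partitions d - {[d], replicate d 1})). fps_const (char_weight d mus lam) * ?P lam)"
    unfolding disconn_coeff_def by simp
  also have "\<dots> = fps_const (char_weight d mus [d]) * ?P [d] +
      (fps_const (char_weight d mus (replicate d 1)) * ?P (replicate d 1) + R2)"
    using ne finite_partitions[of d] by (simp add: R2_def)
  also have "?P (replicate d 1) = dilate (-1) W"
    by (simp only: contents_column content_product_uminus coeff_series_dilate W_def)
  also have "char_weight d mus [d] = 1 / (fact d)\<^sup>2"
  proof -
    have "irr_char [d] (mus ! i) = 1" if "i < length mus" for i
      using that mus by (intro irr_char_row) (auto dest: nth_mem)
    then show ?thesis by (simp add: char_weight_def irrep_dim_row power_divide)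
  qed
  also have "char_weight d mus (replicate d 1) = (-1) ^ (\<Sum>i<length mus. d - length (mus ! i)) / (fact d)\<^sup>2"
  proof -
    have "irr_char (replicate d 1) (mus ! i) = (-1) ^ (d - length (mus ! i))" if "i < length mus" for i
      using that mus by (intro irr_char_column) (auto dest: nth_mem)
    then show ?thesis
      by (simp add: char_weight_def irrep_dim_column[unfolded One_nat_def] irrep_dim_column power_divide power_sum)
  qed
  finally have main: "disconn_coeff ?G d mus e = fps_const (1 / (fact d)\<^sup>2) * W +
      (fps_const ((-1) ^ (\<Sum>i<length mus. d - length (mus ! i)) / (fact d)\<^sup>2) * dilate (-1) W + R2)"
    by (simp only: W_def)
  show ?thesis
  proof
    show "abs_conv (2 / (2 * real d - 3)) (R2 + R1)"
      using abs_conv_add[OF t R2 R1] by (simp add: t_def)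
    show "lookup (hurwitz_conn ?G d mus r) e =
      (1 + (-1) ^ (r + (\<Sum>i<length mus. d - length (mus ! i)))) / (fact d)\<^sup>2 * fps_nth W r + fps_nth (R2 + R1) r" for r
      unfolding R1_nth main by (simp add: dilate_def power_add add_divide_distrib distrib_right)
  qed
qed

text \<open>Converts the normalization by n + 1 into one by r = n + s.\<close>

lemma tendsto_Suc_over_add: "(\<lambda>n. of_nat (Suc n) / of_nat (n + s) :: complex) \<longlonglongrightarrow> 1"
proof -
  have "(\<lambda>n. inverse (1 + (of_nat s - 1) * (1 / of_nat (Suc n))) :: complex) \<longlonglongrightarrow> inverse (1 + (of_nat s - 1) * 0)"
    by (intro tendsto_intros lim_1_over_n[THEN LIMSEQ_Suc]) simp
  moreover have "inverse (1 + (of_nat s - 1) * (1 / of_nat (Suc n))) = (of_nat (Suc n) / of_nat (n + s) :: complex)" for n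
  proof -
    have "1 + (of_nat s - 1) * (1 / of_nat (Suc n)) = (of_nat (n + s) / of_nat (Suc n) :: complex)"
      by (simp add: divide_simps del: of_nat_Suc) simp
    then show ?thesis by simp
  qed
  ultimately show ?thesis by simp
qed

text \<open>The row series is kappa z^s times a K-th power, so its coefficient at r is kappa times
  that of the power at r - s. This shift is the source of the exponents a and b being subtracted in
  the power of d - 1.\<close>

lemma row_coeff_asymp:
  fixes K M L d :: nat and e
  defines "W \<equiv> coeff_series e (content_product (rational_weight K M L) (contents [d]))"
    and "s \<equiv> (\<Sum>i=1..L. lookup e (U i)) + (\<Sum>j=1..M-K. lookup e (V j))"
    and "kappa \<equiv> (\<Prod>i=1..L. of_nat (stirling d (d - lookup e (U i)))) *
               (\<Prod>j=1..M-K. of_nat (Stirling (lookup e (V j) + d - 1) (d - 1))) :: complex"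
  assumes K: "K \<ge> 1" and d: "d \<ge> 2" and e: "Poly_Mapping.keys e \<subseteq> weight_vars L (M - K)" and kappa: "kappa \<noteq> 0"
  shows "(\<lambda>r. fps_nth W r / (of_nat r ^ (K - 1) / fact (K - 1) *
      (of_nat (d - 1) powi (int ((d - 2) * K) - int s + int r) / fact (d - 2) ^ K) * kappa)) \<longlonglongrightarrow> 1"
    (is "(\<lambda>r. fps_nth W r / ?B r) \<longlonglongrightarrow> 1")
proof (rule LIMSEQ_offset[of _ s])
  define rho where "rho = (of_nat (d - 1) :: complex)"
  define l where "l = kappa * ((rho ^ (d - 2) / fact (d - 2)) ^ K / fact (K - 1))"
  define H where "H = content_geometric (contents [d]) ^ K"
  obtain d' where d': "d = Suc d'" "d' > 0" using d by (cases d) auto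
  have rho0: "rho \<noteq> 0" using d by (simp add: rho_def)
  then have l0: "l \<noteq> 0" using kappa by (simp add: l_def)
  have lin: "fps_nth (content_linear (contents [d])) n = of_nat (stirling d (d - n))" for n
    using content_linear_row_nth d by simp
  have geo: "fps_nth (content_geometric (contents [d])) n = of_nat (Stirling (n + d - 1) (d - 1))" for n
    using content_geometric_row_nth[of d' n] d' by simp
  have "W = fps_const kappa * fps_X ^ s * H"
    unfolding W_def coeff_series_content_product if_P[OF e] kappa_def s_def H_def lin geo ..
  then have W_nth: "fps_nth W (n + s) = kappa * fps_nth H n" for n
    by (simp add: mult.assoc fps_X_power_mult_nth)
  have "coeff_asymp (K - 1) (real d') H ((of_nat d' ^ (d' - 1) / fact (d' - 1)) ^ K / fact (K - 1))"
    using coeff_asymp_row[OF K d'(2)] unfolding H_def content_geometric_row d'(1) .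
  then have "(\<lambda>n. fps_nth H n / (of_nat (Suc n) ^ (K - 1) * rho ^ n)) \<longlonglongrightarrow> (rho ^ (d - 2) / fact (d - 2)) ^ K / fact (K - 1)"
    by (simp add: coeff_asymp_def rho_def d' numeral_2_eq_2)
  note tendsto_mult[OF tendsto_divide[OF tendsto_mult[OF tendsto_const[of kappa] this] tendsto_const[of l] l0]
      tendsto_power[OF tendsto_Suc_over_add[of s], of "K - 1"]]
  moreover have "kappa * (fps_nth H n / (of_nat (Suc n) ^ (K - 1) * rho ^ n)) / l * (of_nat (Suc n) / of_nat (n + s)) ^ (K - 1) =
      fps_nth W (n + s) / ?B (n + s)" for n
  proof -
    \<comment> \<open>The integer exponent may be negative for small r; at r = n + s it is the
      natural number (d - 2) K + n.\<close>
    have "rho powi (int ((d - 2) * K) - int s + int (n + s)) = rho powi int ((d - 2) * K + n)"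
      by (rule arg_cong[of _ _ "power_int rho"]) simp
    also have "\<dots> = (rho ^ (d - 2)) ^ K * rho ^ n"
      by (simp only: power_int_of_nat power_add power_mult)
    finally have "?B (n + s) = of_nat (n + s) ^ (K - 1) * (l * rho ^ n)"
      by (simp add: rho_def l_def power_divide ac_simps del: of_nat_add)
    then show ?thesis
      by (simp add: W_nth power_divide del: of_nat_Suc of_nat_add)
  qed
  moreover have "kappa * ((rho ^ (d - 2) / fact (d - 2)) ^ K / fact (K - 1)) / l * 1 ^ (K - 1) = 1"
    using l0 unfolding l_def power_one mult_1_right by (rule divide_self)
  ultimately show "(\<lambda>n. fps_nth W (n + s) / ?B (n + s)) \<longlonglongrightarrow> 1"
    by (simp only:)
qed

text \<open>Since n t is at least 1, dividing by n^r costs no more than multiplying by t^r, and the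
  terms of a convergent series tend to 0. For r > 0 the factor r^m only helps.\<close>

lemma abs_conv_negligible:
  fixes R :: "complex fps" and lambda :: complex
  assumes R: "abs_conv t R" and t: "t > 0" "real n * t \<ge> 1" and lambda: "lambda \<noteq> 0"
  shows "(\<lambda>r. fps_nth R r / (of_nat r ^ m * (lambda * of_nat n ^ r))) \<longlonglongrightarrow> 0"
proof (rule Lim_null_comparison)
  have "(\<lambda>r. norm (fps_nth R r * of_real t ^ r) / norm lambda) \<longlonglongrightarrow> norm (0 :: complex) / norm lambda"
    using lambda by (intro tendsto_intros abs_conv_tendsto_0 R t) simp
  then show "(\<lambda>r. norm (fps_nth R r * of_real t ^ r) / norm lambda) \<longlonglongrightarrow> 0" by simp
  show "\<forall>\<^sub>F r in sequentially. norm (fps_nth R r / (of_nat r ^ m * (lambda * of_nat n ^ r))) \<le>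
      norm (fps_nth R r * of_real t ^ r) / norm lambda"
    using eventually_gt_at_top[of 0]
  proof eventually_elim
    case (elim r)
    have n: "n > 0" using t by (cases n) auto
    have "1 * 1 \<le> real r ^ m * (real n * t) ^ r"
      using elim t by (intro mult_mono one_le_power) auto
    then have "norm (fps_nth R r) * 1 \<le> norm (fps_nth R r) * (real r ^ m * (real n * t) ^ r)"
      by (intro mult_left_mono) auto
    then have "norm (fps_nth R r) \<le> norm (fps_nth R r) * t ^ r * (real r ^ m * real n ^ r)"
      by (simp add: power_mult_distrib ac_simps)
    moreover have "real r ^ m * real n ^ r > 0" using elim n by simp
    ultimately have "norm (fps_nth R r) / (real r ^ m * real n ^ r) / norm lambda \<le> norm (fps_nth R r) * t ^ r / norm lambda"
      by (intro divide_right_mono) (simp_all add: pos_divide_le_eq)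
    then show ?case using t(1) by (simp add: norm_divide norm_mult norm_power mult.commute mult.left_commute)
  qed
qed

theorem theorem3:
  fixes K M L N d :: nat and mus :: "nat list list" and a b :: "nat \<Rightarrow> nat"
  assumes "K \<ge> 1" and "M \<ge> K" and "d \<ge> 2"
    and "length mus = N" and "\<forall>mu\<in>set mus. mu \<in> partitions d"
  shows
    "let r = (\<lambda>g::nat. nat (2 * int g - 2 - int d * (int N - 2) + (\<Sum>j<N. int (length (mus ! j)))));
         e = (\<Sum>i=1..L. Poly_Mapping.single (U i) (a i)) +
             (\<Sum>j=1..M-K. Poly_Mapping.single (V j) (b j));
         A = (\<lambda>g. Poly_Mapping.lookup (hurwitz_conn (rational_weight K M L) d mus (r g)) e);
         B = (\<lambda>g. 2 * (of_nat (r g) ^ (K - 1) / fact (K - 1)) *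
               (of_nat (d - 1) powi
                  (int ((d - 2) * K) - (\<Sum>i=1..L. int (a i)) - (\<Sum>j=1..M-K. int (b j)) + int (r g))
                / ((fact d)\<^sup>2 * fact (d - 2) ^ K)) *
               (\<Prod>i=1..L. of_nat (stirling d (d - a i))) *
               (\<Prod>j=1..M-K. of_nat (Stirling (b j + d - 1) (d - 1))))
     in A \<sim>[at_top] B \<and> ((\<forall>g. B g = 0) \<longrightarrow> (\<forall>g. A g = 0))"
proof -
  define r where "r = (\<lambda>g::nat. nat (2 * int g - 2 - int d * (int N - 2) + (\<Sum>j<N. int (length (mus ! j)))))"
  define e where "e = (\<Sum>i=1..L. Poly_Mapping.single (U i) (a i)) + (\<Sum>j=1..M-K. Poly_Mapping.single (V j) (b j))"
  define A where "A = (\<lambda>g. lookup (hurwitz_conn (rational_weight K M L) d mus (r g)) e)"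
  define B :: "nat \<Rightarrow> complex" where
    "B = (\<lambda>g. 2 * (of_nat (r g) ^ (K - 1) / fact (K - 1)) *
               (of_nat (d - 1) powi
                  (int ((d - 2) * K) - (\<Sum>i=1..L. int (a i)) - (\<Sum>j=1..M-K. int (b j)) + int (r g))
                / ((fact d)\<^sup>2 * fact (d - 2) ^ K)) *
               (\<Prod>i=1..L. of_nat (stirling d (d - a i))) *
               (\<Prod>j=1..M-K. of_nat (Stirling (b j + d - 1) (d - 1))))"
  note d = \<open>d \<ge> 2\<close>
  have mus: "set mus \<subseteq> partitions d" using assms(5) by blast
  have eU: "lookup e (U i) = a i" if "i \<in> {1..L}" for i
    using that by (simp add: e_def lookup_add lookup_sum lookup_single when_def)
  have eV: "lookup e (V j) = b j" if "j \<in> {1..M-K}" for j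
    using that by (simp add: e_def lookup_add lookup_sum lookup_single when_def)
  have keys: "Poly_Mapping.keys e \<subseteq> weight_vars L (M - K)"
  proof
    fix x assume "x \<in> Poly_Mapping.keys e"
    then have "lookup e x \<noteq> 0" by (simp add: in_keys_iff)
    then show "x \<in> weight_vars L (M - K)"
      by (cases x) (auto simp: e_def lookup_add lookup_sum lookup_single when_def weight_vars_def split: if_splits)
  qed
  define s where "s = (\<Sum>i=1..L. a i) + (\<Sum>j=1..M-K. b j)"
  define kappa :: complex where "kappa = (\<Prod>i=1..L. of_nat (stirling d (d - a i))) *
               (\<Prod>j=1..M-K. of_nat (Stirling (b j + d - 1) (d - 1)))"
  define beta :: "nat \<Rightarrow> complex" where
    "beta = (\<lambda>r. of_nat r ^ (K - 1) / fact (K - 1) *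
      (of_nat (d - 1) powi (int ((d - 2) * K) - int s + int r) / fact (d - 2) ^ K) * kappa)"
  have B: "B g = 2 / (fact d)\<^sup>2 * beta (r g)" for g
  proof -
    have eq: "int ((d - 2) * K) - (\<Sum>i=1..L. int (a i)) - (\<Sum>j=1..M-K. int (b j)) = int ((d - 2) * K) - int s"
      by (simp add: s_def)
    show ?thesis unfolding B_def eq beta_def kappa_def by (simp add: ac_simps)
  qed
  \<comment> \<open>For large g the integer inside \<open>nat\<close> exceeds g, so the truncation
    at 0 has no effect in the limit.\<close>
  have r_lim: "filterlim r at_top sequentially"
  proof (rule filterlim_at_top_mono[OF filterlim_ident])
    show "\<forall>\<^sub>F g in sequentially. g \<le> r g"
      using eventually_ge_at_top[of "d * N + 2"]
    proof eventually_elim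
      case (elim g)
      have "int g \<ge> int d * int N + 2" using elim by (metis of_nat_add of_nat_le_iff of_nat_mult of_nat_numeral)
      moreover have "(\<Sum>j<N. int (length (mus ! j))) \<ge> 0" by (simp add: sum_nonneg)
      ultimately show ?case unfolding r_def by (simp add: algebra_simps)
    qed
  qed
  have "A \<sim>[at_top] B \<and> ((\<forall>g. B g = 0) \<longrightarrow> (\<forall>g. A g = 0))"
  proof (cases "\<exists>i\<in>{1..L}. a i \<ge> d")
    case True
    then obtain i where i: "i \<in> {1..L}" "a i \<ge> d" by blast
    have "A g = 0" for g
      unfolding A_def by (rule hurwitz_conn_eq_0[OF _ mus i(1)]) (use d i eU in auto)
    moreover have "kappa = 0"
      using i d unfolding kappa_def by (auto simp: prod_zero_iff intro!: bexI[of _ i])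
    then have "B g = 0" for g by (simp add: B beta_def)
    ultimately have "A = (\<lambda>_. 0)" "B = (\<lambda>_. 0)" by auto
    then show ?thesis by simp
  next
    case False
    then have kappa: "kappa \<noteq> 0"
      using d by (auto simp: kappa_def prod_zero_iff stirling_pos Stirling_pos not_le
          intro!: gr_implies_not0[OF stirling_pos] gr_implies_not0[OF Stirling_pos])
    define W where "W = coeff_series e (content_product (rational_weight K M L) (contents [d]))"
    define S where "S = (\<Sum>i<length mus. d - length (mus ! i))"
    obtain R where R: "abs_conv (2 / (2 * real d - 3)) R"
      and A: "\<And>r. lookup (hurwitz_conn (rational_weight K M L) d mus r) e =
        (1 + (-1) ^ (r + S)) / (fact d)\<^sup>2 * fps_nth W r + fps_nth R r"
      using hurwitz_conn_decomposition[OF d mus, of K M L e] unfolding W_def S_def by blast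
    have W_lim: "(\<lambda>r. fps_nth W r / beta r) \<longlonglongrightarrow> 1"
      using row_coeff_asymp[OF \<open>K \<ge> 1\<close> d keys] kappa
      unfolding W_def beta_def kappa_def s_def by (simp add: eU eV)
    \<comment> \<open>The part of \<open>beta\<close> that does not depend on r, so that the
      remainder can be compared with r^(K - 1) (d - 1)^r.\<close>
    define lambda :: complex where
      "lambda = of_nat (d - 1) powi (int ((d - 2) * K) - int s) / fact (d - 2) ^ K * kappa / fact (K - 1)"
    have beta: "beta r = of_nat r ^ (K - 1) * (lambda * of_nat (d - 1) ^ r)" for r
      using d by (simp add: beta_def lambda_def power_int_add ac_simps)
    have lambda: "lambda \<noteq> 0" using d kappa by (simp add: lambda_def)
    have R_lim: "(\<lambda>r. fps_nth R r / beta r) \<longlonglongrightarrow> 0"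
      unfolding beta
    proof (rule abs_conv_negligible[OF R _ _ lambda])
      have "2 * real d - 3 > 0" using d by simp
      then show "2 / (2 * real d - 3) > 0" "real (d - 1) * (2 / (2 * real d - 3)) \<ge> 1"
        using d by (simp_all add: of_nat_diff field_simps)
    qed
    \<comment> \<open>With the genus formula, r + S = 2 (g - 1 + d), so row and column reinforce
      each other instead of cancelling.\<close>
    have even: "even (r g + S)" if "g > d * N" for g
    proof -
      have "int d * int N < int g" using that by (metis of_nat_less_iff of_nat_mult)
      moreover have "(\<Sum>j<N. int (length (mus ! j))) \<ge> 0" by (simp add: sum_nonneg)
      ultimately have "int (r g) = 2 * int g - 2 - int d * (int N - 2) + (\<Sum>j<N. int (length (mus ! j)))"
        unfolding r_def using d by (simp add: algebra_simps)
      moreover have "int S = (\<Sum>j<N. int d - int (length (mus ! j)))"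
        unfolding S_def of_nat_sum assms(4)
      proof (rule sum.cong[OF refl])
        fix j assume "j \<in> {..<N}"
        then have "mus ! j \<in> partitions d" using assms(4,5) by auto
        then show "int (d - length (mus ! j)) = int d - int (length (mus ! j))"
          using partitions_memD(1) by (simp add: of_nat_diff)
      qed
      ultimately have "int (r g + S) = 2 * (int g - 1 + int d)"
        by (simp add: sum_subtractf algebra_simps)
      then show ?thesis by (metis dvd_triv_left even_of_nat)
    qed
    have "(\<lambda>g. A g / B g) \<longlonglongrightarrow> 1"
    proof (rule Lim_transform_eventually)
      have "(\<lambda>r. fps_nth W r / beta r + (fact d)\<^sup>2 / 2 * (fps_nth R r / beta r)) \<longlonglongrightarrow> 1 + (fact d)\<^sup>2 / 2 * 0"
        by (intro tendsto_intros W_lim R_lim)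
      then show "(\<lambda>g. fps_nth W (r g) / beta (r g) + (fact d)\<^sup>2 / 2 * (fps_nth R (r g) / beta (r g))) \<longlonglongrightarrow> 1"
        using filterlim_compose[OF _ r_lim] by force
      show "\<forall>\<^sub>F g in sequentially.
          fps_nth W (r g) / beta (r g) + (fact d)\<^sup>2 / 2 * (fps_nth R (r g) / beta (r g)) = A g / B g"
        using eventually_gt_at_top[of "d * N"]
      proof eventually_elim
        case (elim g)
        have "(-1 :: complex) ^ (r g + S) = 1" using even[OF elim] by simp
        then have "A g = 2 / (fact d)\<^sup>2 * fps_nth W (r g) + fps_nth R (r g)"
          by (simp add: A_def A)
        then have "A g / B g = 2 / (fact d)\<^sup>2 * fps_nth W (r g) / (2 / (fact d)\<^sup>2 * beta (r g)) +
            fps_nth R (r g) / (2 / (fact d)\<^sup>2 * beta (r g))"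
          by (simp only: B add_divide_distrib)
        then show ?case by simp
      qed
    qed
    then have "A \<sim>[at_top] B" by (rule asymp_equivI')
    \<comment> \<open>In this case the second conjunct holds vacuously; r at least 1 ensures that
      r^(K - 1) is nonzero.\<close>
    moreover have "\<exists>g. B g \<noteq> 0"
    proof -
      have "\<forall>\<^sub>F g in sequentially. r g \<ge> 1" using r_lim by (simp add: filterlim_at_top)
      then obtain g where "r g \<ge> 1" by (auto simp: eventually_sequentially)
      then have "B g \<noteq> 0" using d lambda by (simp add: B beta)
      then show ?thesis ..
    qed
    ultimately show ?thesis by blast
  qed
  then show ?thesis
    unfolding Let_def A_def B_def r_def e_def .
qed

end
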